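(* There are absolute constants $C,c>0$ such that for $C\le d\le cn$ and $0<p\le c/\ln d$ (with $p<1/2$) one has $$\mathbb{P}\big(\mathcal{E}^{AC}(p)\big)\ge1-\left(\frac{Cd}{n}\right)^{cd}.$$
   Context: $n,d$ are positive integers. $\mathcal{M}_{n,d}$ is the set of all $n\times n$ matrices with entries in $\{0,1\}$ with exactly $d$ ones in every row and every column, and $\mathbb{P}$ is the normalized counting measure on $\mathcal{M}_{n,d}$. For $0<p<1/2$, the set of almost constant vectors is $$AC(p)=\{x\in\mathbb{R}^n\setminus\{0\}\,:\,\exists\lambda_x\in\mathbb{R}\ \ |\{i\,:\,x_i=\lambda_x\}|\ge(1-p)n\},$$ and $$\mathcal{E}^{AC}(p)=\{M\in\mathcal{M}_{n,d}\,:\,\forall x\in AC(p)\quad Mx\ne0\ \text{ and }\ x^TM\ne0\}.$$ Absolute constants are independent of all parameters. *)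

theory Defs
  imports "HOL-Analysis.Nonnegative_Lebesgue_Integration" "Jordan_Normal_Form.Matrix"
begin

definition regular_01_mats :: "nat \<Rightarrow> nat \<Rightarrow> real mat set" where
  "regular_01_mats n d =
     {M \<in> carrier_mat n n.
        (\<forall>i<n. \<forall>j<n. M $$ (i, j) \<in> {0, 1}) \<and>
        (\<forall>i<n. card {j. j < n \<and> M $$ (i, j) = 1} = d) \<and>
        (\<forall>j<n. card {i. i < n \<and> M $$ (i, j) = 1} = d)}"

definition almost_constant :: "nat \<Rightarrow> real \<Rightarrow> real vec set" where
  "almost_constant n p =
     {x \<in> carrier_vec n. x \<noteq> 0\<^sub>v n \<and>
        (\<exists>a. real (card {i. i < n \<and> vec_index x i = a}) \<ge> (1 - p) * real n)}"

text \<open>The row vector \<open>x\<^sup>T M\<close> is the \<open>1 \<times> n\<close> matrix \<open>mat_of_row x * M\<close>.\<close>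

definition event_AC :: "nat \<Rightarrow> nat \<Rightarrow> real \<Rightarrow> real mat set" where
  "event_AC n d p =
     {M \<in> regular_01_mats n d.
        \<forall>x \<in> almost_constant n p. M *\<^sub>v x \<noteq> 0\<^sub>v n \<and> mat_of_row x * M \<noteq> 0\<^sub>m 1 n}"

end

theory Submission
  imports Defs "HOL-Real_Asymp.Real_Asymp"
begin

text \<open>
  A matrix is identified with the edge set of a \<open>d\<close>-regular bipartite graph. Switching edges shows
  that a fixed set \<open>T\<close> of positions is occupied with probability at most \<open>(2d/n)\<^bsup>|T|\<^esup>\<close>; union bounds
  then give expansion of all column sets \<open>J\<close> with \<open>d|J| \<le> c\<^sub>0 n\<close>.

  Let \<open>x\<close> equal a constant \<open>a\<close> exactly off \<open>J\<close>. If \<open>d|J| \<le> c\<^sub>0 n\<close>, expansion provides a row with exactly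
  one entry in \<open>J\<close> (which settles \<open>a = 0\<close>) and a row with none (which settles \<open>a \<noteq> 0\<close>).

  If \<open>J\<close> is larger, group the rows into pairs \<open>i\<close>, \<open>h + i\<close>. Given the union and intersection of the two
  rows of every pair, the first row receives a uniform half of the symmetric difference,
  independently over the pairs. For a fixed \<open>x\<close> that is not constant on that difference, the product
  with the row vanishes with probability at most \<open>3/4\<close>, and by expansion this concerns linearly many
  pairs. A kernel vector is determined by \<open>|J| + 1\<close> rows, so a union bound over \<open>J\<close> and over these rows
  (Komlos' argument) costs only \<open>exp (\<epsilon>n)\<close> and gives an exponentially small probability.
\<close>

section \<open>Switchings in regular bipartite graphs\<close>

text \<open>Two regimes need different sources of smallness. For \<open>J\<close> with
  \<open>d * card J\<close> below a small multiple of n, summing the switching bounds over all sizes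
  of \<open>J\<close> gives order (Cd/n)^(d/8), the smallest sets dominating. For
  \<open>card J\<close> of order n there are exponentially many candidates, so independent choices
  are needed, whereas the entries of a uniform regular matrix are dependent. Redistributing entries
  inside fixed pairs of rows preserves all row and column degrees, so conditionally on the rest the
  choices form a genuine product. The expansion factor 3/4 serves three purposes: exceeding 1/2 it
  forces a unique neighbour; it makes two rows share fewer than d/2 columns; and it leaves enough
  rows after discarding pairs that see the same column of \<open>J\<close> twice. The resulting
  exponential term is harmless, because d ln(n/d) \<le> n shows that the target (Cd/n)^(cd) is never
  below exp(-cn). Left null vectors are right null vectors of the transpose, so one side may use
  only half of the target.\<close>

lemma sum_Pow_power_card:
  fixes t :: real
  assumes "finite X"
  shows "(\<Sum>A\<in>Pow X. t ^ card A) = (1 + t) ^ card X"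
  using assms
proof (induction X)
  case (insert a X)
  have "(\<Sum>A\<in>Pow (insert a X). t ^ card A)
      = (\<Sum>A\<in>Pow X. t ^ card A) + (\<Sum>A\<in>insert a ` Pow X. t ^ card A)"
    unfolding Pow_insert using insert.hyps by (intro sum.union_disjoint) auto
  also have "(\<Sum>A\<in>insert a ` Pow X. t ^ card A) = (\<Sum>A\<in>Pow X. t ^ card (insert a A))"
    using insert.hyps by (subst sum.reindex) (auto intro!: inj_onI)
  also have "\<dots> = (\<Sum>A\<in>Pow X. t * t ^ card A)"
  proof (intro sum.cong refl)
    fix A assume "A \<in> Pow X"
    then have "finite A" "a \<notin> A" using insert.hyps finite_subset by auto
    then show "t ^ card (insert a A) = t * t ^ card A" by simp
  qed
  finally show ?case
    using insert by (simp add: sum_distrib_left[symmetric] algebra_simps)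
qed simp

text \<open>Exponential weighting: each counted set has weight \<open>t ^ card A\<close> at least
  \<open>t ^ k\<close>, while all subsets together weigh (1 + t)^|X|. The parameter stays free
  because a small constant \<open>t\<close> later gives bounds of the form exp(\<epsilon>
  n).\<close>

lemma card_small_subsets_le:
  fixes t :: real
  assumes "finite X" "0 < t" "t \<le> 1"
  shows "real (card {A. A \<subseteq> X \<and> card A \<le> k}) \<le> (1 / t) ^ k * exp (t * real (card X))"
proof -
  have "real (card {A. A \<subseteq> X \<and> card A \<le> k}) * t ^ k
      = (\<Sum>A\<in>{A. A \<subseteq> X \<and> card A \<le> k}. t ^ k)"
    by simp
  also have "\<dots> \<le> (\<Sum>A\<in>{A. A \<subseteq> X \<and> card A \<le> k}. t ^ card A)"
    using assms by (intro sum_mono power_decreasing) auto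
  also have "\<dots> \<le> (\<Sum>A\<in>Pow X. t ^ card A)"
    using assms by (intro sum_mono2) auto
  also have "\<dots> = (1 + t) ^ card X"
    using assms sum_Pow_power_card by blast
  also have "\<dots> \<le> exp t ^ card X"
    using assms by (intro power_mono) (auto simp: exp_ge_add_one_self)
  also have "\<dots> = exp (t * real (card X))"
    by (simp add: exp_of_nat_mult[symmetric] mult.commute)
  finally show ?thesis
    using assms by (simp add: field_simps power_divide)
qed

text \<open>The weight t = k/n minimises the preceding bound and gives (en/k)^k; e is rounded up to
  3.\<close>

lemma binomial_le_three_pow:
  assumes "0 < k"
  shows "real (n choose k) \<le> (3 * real n / real k) ^ k"
proof (cases "k \<le> n")
  case True
  let ?t = "real k / real n"
  have n: "0 < n" using assms True by simp
  have "n choose k = card {A. A \<subseteq> {..<n} \<and> card A = k}"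
    by (simp add: n_subsets)
  also have "\<dots> \<le> card {A. A \<subseteq> {..<n} \<and> card A \<le> k}"
    by (intro card_mono) auto
  finally have "real (n choose k) \<le> real (card {A. A \<subseteq> {..<n} \<and> card A \<le> k})"
    by (rule of_nat_mono)
  also have "\<dots> \<le> (1 / ?t) ^ k * exp (?t * real (card {..<n}))"
    using assms True n by (intro card_small_subsets_le) auto
  also have "exp (?t * real (card {..<n})) = exp 1 ^ k"
    using n by (simp add: exp_of_nat_mult[symmetric])
  also have "(1 / ?t) ^ k * exp 1 ^ k \<le> (1 / ?t) ^ k * 3 ^ k"
    by (intro mult_left_mono power_mono exp_le) auto
  also have "\<dots> = (3 * real n / real k) ^ k"
    by (simp add: power_mult_distrib[symmetric] mult.commute)
  finally show ?thesis .
qed (simp add: not_le binomial_eq_0)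

lemma card_le_of_cover:
  assumes "finite \<A>" "B \<subseteq> (\<Union>a\<in>\<A>. F a)" "\<And>a. a \<in> \<A> \<Longrightarrow> finite (F a)"
    "\<And>a. a \<in> \<A> \<Longrightarrow> real (card (F a)) \<le> c"
  shows "real (card B) \<le> real (card \<A>) * c"
proof -
  have "card B \<le> card (\<Union>a\<in>\<A>. F a)"
    using assms by (intro card_mono) auto
  also have "\<dots> \<le> (\<Sum>a\<in>\<A>. card (F a))"
    using assms(1) by (rule card_UN_le)
  finally have "real (card B) \<le> (\<Sum>a\<in>\<A>. real (card (F a)))"
    by (metis of_nat_le_iff of_nat_sum)
  also have "\<dots> \<le> (\<Sum>a\<in>\<A>. c)"
    using assms(4) by (intro sum_mono)
  finally show ?thesis by simp
qed

section \<open>Edge sets of regular bipartite graphs\<close>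

definition reg :: "nat \<Rightarrow> nat \<Rightarrow> (nat \<times> nat) set set" where
  "reg n d = {E. E \<subseteq> {..<n} \<times> {..<n} \<and>
     (\<forall>i<n. card (E `` {i}) = d) \<and> (\<forall>j<n. card (E\<inverse> `` {j}) = d)}"

lemma reg_subset: "E \<in> reg n d \<Longrightarrow> E \<subseteq> {..<n} \<times> {..<n}"
  and reg_row: "E \<in> reg n d \<Longrightarrow> i < n \<Longrightarrow> card (E `` {i}) = d"
  and reg_col: "E \<in> reg n d \<Longrightarrow> j < n \<Longrightarrow> card (E\<inverse> `` {j}) = d"
  by (auto simp: reg_def)

lemma finite_reg: "finite (reg n d)"
  by (rule finite_subset[of _ "Pow ({..<n} \<times> {..<n})"]) (auto simp: reg_def)

lemma reg_finite: "E \<in> reg n d \<Longrightarrow> finite E"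
  by (rule finite_subset[OF reg_subset]) auto

lemma finite_Image_reg: "E \<in> reg n d \<Longrightarrow> finite (E `` A)" "E \<in> reg n d \<Longrightarrow> finite (E\<inverse> `` A)"
  by (simp_all add: reg_finite finite_Image)

lemma reg_Image_subset: "E \<in> reg n d \<Longrightarrow> E `` A \<subseteq> {..<n}" "E \<in> reg n d \<Longrightarrow> E\<inverse> `` A \<subseteq> {..<n}"
  using reg_subset by blast+

lemma converse_reg_iff [simp]: "E\<inverse> \<in> reg n d \<longleftrightarrow> E \<in> reg n d"
  by (auto simp: reg_def)

lemma card_Int_rows:
  assumes "E \<in> reg n d" "I \<subseteq> {..<n}"
  shows "card (E \<inter> I \<times> UNIV) = card I * d"
proof -
  have "E \<inter> I \<times> UNIV = (SIGMA i:I. E `` {i})" by auto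
  then show ?thesis
    using assms finite_subset[OF assms(2)] finite_Image_reg(1)[OF assms(1)] reg_row[OF assms(1)]
    by (simp add: subset_iff)
qed

lemma card_Int_cols:
  assumes "E \<in> reg n d" "J \<subseteq> {..<n}"
  shows "card (E \<inter> UNIV \<times> J) = card J * d"
proof -
  have "E \<inter> UNIV \<times> J = (E\<inverse> \<inter> J \<times> UNIV)\<inverse>" by auto
  then show ?thesis
    using card_Int_rows[of "E\<inverse>" n d J] assms by (simp add: card_inverse)
qed

lemma card_reg:
  assumes "E \<in> reg n d"
  shows "card E = n * d"
proof -
  have "E \<inter> {..<n} \<times> UNIV = E" using reg_subset[OF assms] by auto
  then show ?thesis using card_Int_rows[OF assms, of "{..<n}"] by simp
qed

definition switch :: "nat \<times> nat \<Rightarrow> nat \<times> nat \<Rightarrow> (nat \<times> nat) set \<Rightarrow> (nat \<times> nat) set" where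
  "switch e e' E = E - {e, e'} \<union> {(fst e, snd e'), (fst e', snd e)}"

lemma switch_row:
  assumes "(i, j) \<in> E" "(i', j') \<in> E" "(i, j') \<notin> E" "(i', j) \<notin> E"
  shows "switch (i, j) (i', j') E `` {i} = insert j' (E `` {i} - {j})"
    and "switch (i, j) (i', j') E `` {i'} = insert j (E `` {i'} - {j'})"
    and "k \<noteq> i \<Longrightarrow> k \<noteq> i' \<Longrightarrow> switch (i, j) (i', j') E `` {k} = E `` {k}"
proof -
  have "i \<noteq> i'" using assms by auto
  then show "switch (i, j) (i', j') E `` {i} = insert j' (E `` {i} - {j})"
    and "switch (i, j) (i', j') E `` {i'} = insert j (E `` {i'} - {j'})"
    and "k \<noteq> i \<Longrightarrow> k \<noteq> i' \<Longrightarrow> switch (i, j) (i', j') E `` {k} = E `` {k}"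
    unfolding switch_def by (simp_all add: set_eq_iff)
qed

lemma switch_converse: "(switch (i, j) (i', j') E)\<inverse> = switch (j, i) (j', i') (E\<inverse>)"
  unfolding switch_def by auto

lemma card_swap_element:
  assumes "finite A" "a \<in> A" "b \<notin> A"
  shows "card (insert b (A - {a})) = card A"
proof -
  have "card (insert b (A - {a})) = Suc (card (A - {a}))"
    using assms by (intro card_insert_disjoint) auto
  then show ?thesis using card_Suc_Diff1[OF assms(1,2)] by (rule trans)
qed

lemma switch_reg:
  assumes "E \<in> reg n d" "(i, j) \<in> E" "(i', j') \<in> E" "(i, j') \<notin> E" "(i', j) \<notin> E"
  shows "switch (i, j) (i', j') E \<in> reg n d"
proof -
  \<comment> \<open>Stated for arbitrary \<open>F\<close> and indices, so that applying it to the
    converse relation also yields the column degrees.\<close>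
  have rows: "card (switch (i, j) (i', j') F `` {k}) = card (F `` {k})"
    if "(i, j) \<in> F" "(i', j') \<in> F" "(i, j') \<notin> F" "(i', j) \<notin> F" "finite F" for F i j i' j' k
  proof -
    have f: "finite (F `` {l})" for l using that(5) by (rule finite_Image)
    have "card (insert j' (F `` {i} - {j})) = card (F `` {i})"
      "card (insert j (F `` {i'} - {j'})) = card (F `` {i'})"
      using card_swap_element[OF f, of j i j'] card_swap_element[OF f, of j' i' j] that by simp_all
    then show ?thesis
      using switch_row[OF that(1-4)] by (cases "k = i"; cases "k = i'") simp_all
  qed
  have "switch (i, j) (i', j') E \<subseteq> {..<n} \<times> {..<n}"
    using assms reg_subset[OF assms(1)] unfolding switch_def by auto
  moreover have "card (switch (i, j) (i', j') E `` {k}) = d" if "k < n" for k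
    using rows[OF assms(2-5) reg_finite[OF assms(1)]] reg_row[OF assms(1) that] by simp
  moreover have "card ((switch (i, j) (i', j') E)\<inverse> `` {k}) = d" if "k < n" for k
    using rows[of j i "E\<inverse>" j' i' k] assms(2-5) reg_finite[OF assms(1)] reg_col[OF assms(1) that]
    by (simp add: switch_converse)
  ultimately show ?thesis unfolding reg_def by (intro CollectI conjI allI impI)
qed

text \<open>Adding one position to \<open>T\<close> costs a factor \<open>2d/n\<close>: an edge \<open>e\<close> outside \<open>T\<close> can be switched away
  in at least \<open>nd - 2d\<^sup>2 - |T| \<ge> nd/2\<close> ways, and each graph without \<open>e\<close> arises in at most \<open>d\<^sup>2\<close> ways.\<close>

lemma card_reg_insert_le:
  assumes d: "4 \<le> d" "8 * d \<le> n" and T: "finite T" "card T \<le> n" and e: "e \<notin> T"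
    and en: "e \<in> {..<n} \<times> {..<n}"
  shows "real n * real (card {E \<in> reg n d. insert e T \<subseteq> E}) \<le> 2 * real d * real (card {E \<in> reg n d. T \<subseteq> E})"
proof -
  obtain i j where ij: "e = (i, j)" by fastforce
  have lt: "i < n" "j < n" using en ij by auto
  define A where "A = {E \<in> reg n d. insert e T \<subseteq> E}"
  define B where "B = {E \<in> reg n d. T \<subseteq> E \<and> e \<notin> E}"
  define W where "W E = {f \<in> E. f \<notin> T \<and> (i, snd f) \<notin> E \<and> (fst f, j) \<notin> E}" for E :: "(nat \<times> nat) set"
  \<comment> \<open>After \<open>e\<close> has been switched with f = (a, b), both (a, j) and (i, b)
    are edges, so \<open>f\<close> is one of only d * d candidates read off from the new
    graph.\<close>
  define V where "V E = (E\<inverse> `` {j}) \<times> (E `` {i})" for E :: "(nat \<times> nat) set"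
  have fin: "finite A" "finite B" unfolding A_def B_def using finite_reg by auto
  have finW: "finite (W E)" if "E \<in> A" for E
    using that reg_finite unfolding W_def A_def by auto
  have finV: "finite (V E)" if "E \<in> B" for E
    using that finite_Image_reg unfolding V_def B_def by auto
  have W_ge: "n * d \<le> 2 * card (W E)" if "E \<in> A" for E
  proof -
    have E: "E \<in> reg n d" using that unfolding A_def by auto
    \<comment> \<open>An edge is unsuitable for switching only if it lies in \<open>T\<close>, ends
      in a column already used by row \<open>i\<close>, or starts in a row already using column
      \<open>j\<close>.\<close>
    have "E \<subseteq> W E \<union> T \<union> (E \<inter> UNIV \<times> (E `` {i})) \<union> (E \<inter> (E\<inverse> `` {j}) \<times> UNIV)"
      unfolding W_def by auto
    then have "card E \<le> card (W E \<union> T \<union> (E \<inter> UNIV \<times> (E `` {i})) \<union> (E \<inter> (E\<inverse> `` {j}) \<times> UNIV))"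
      using finW[OF that] T reg_finite[OF E] by (intro card_mono) auto
    also have "\<dots> \<le> card (W E) + card T + card (E \<inter> UNIV \<times> (E `` {i})) + card (E \<inter> (E\<inverse> `` {j}) \<times> UNIV)"
      by (intro order.trans[OF card_Un_le] add_mono order.refl)
    also have "card (E \<inter> UNIV \<times> (E `` {i})) = d * d"
      using card_Int_cols[OF E reg_Image_subset(1)[OF E]] reg_row[OF E lt(1)] by simp
    also have "card (E \<inter> (E\<inverse> `` {j}) \<times> UNIV) = d * d"
      using card_Int_rows[OF E reg_Image_subset(2)[OF E]] reg_col[OF E lt(2)] by simp
    finally have "n * d \<le> card (W E) + n + 2 * (d * d)"
      using T card_reg[OF E] by simp
    \<comment> \<open>The losses n and 2d^2 are each at most nd/4, which leaves nd/2.\<close>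
    moreover have "n * 4 \<le> n * d" by (rule mult_le_mono2[OF d(1)])
    moreover have "8 * (d * d) \<le> n * d" using mult_le_mono1[OF d(2), of d] by (simp only: mult.assoc)
    ultimately show ?thesis by linarith
  qed
  have V_eq: "card (V E) = d * d" if "E \<in> B" for E
    using that reg_row[of E n d i] reg_col[of E n d j] lt
    unfolding V_def B_def by (simp add: card_cartesian_product)
  let ?\<phi> = "\<lambda>(E, f). (switch e f E, (fst f, snd f))"
  have "card (Sigma A W) \<le> card (Sigma B V)"
  proof (rule card_inj_on_le)
    show "inj_on ?\<phi> (Sigma A W)"
    proof (rule inj_onI, clarsimp)
      fix E a b E'
      assume E: "E \<in> A" "(a, b) \<in> W E" and E': "E' \<in> A" "(a, b) \<in> W E'"
        and eq: "switch e (a, b) E = switch e (a, b) E'"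
      \<comment> \<open>Knowing \<open>f\<close>, the switch can be undone: the two inserted pairs
        were non-edges before.\<close>
      have "F = switch e (a, b) F - {(i, b), (a, j)} \<union> {(i, j), (a, b)}"
        if "F \<in> A" "(a, b) \<in> W F" for F
        using that unfolding switch_def A_def W_def ij by auto
      from this[OF E] this[OF E'] show "E = E'" unfolding eq by simp
    qed
    show "?\<phi> ` Sigma A W \<subseteq> Sigma B V"
    proof clarsimp
      fix E a b assume E: "E \<in> A" and w: "(a, b) \<in> W E"
      have "switch e (a, b) E \<in> reg n d"
        using E w unfolding ij A_def W_def by (intro switch_reg) auto
      then show "switch e (a, b) E \<in> B \<and> (a, b) \<in> V (switch e (a, b) E)"
        using E w e unfolding ij A_def B_def W_def V_def switch_def by auto
    qed
    show "finite (Sigma B V)" using fin finV by auto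
  qed
  moreover have "card (Sigma A W) = (\<Sum>E\<in>A. card (W E))" using fin finW by simp
  moreover have "card (Sigma B V) = card B * (d * d)" using fin finV V_eq by simp
  ultimately have "(\<Sum>E\<in>A. card (W E)) \<le> card B * (d * d)" by simp
  moreover have "card A * (n * d) \<le> 2 * (\<Sum>E\<in>A. card (W E))"
    unfolding sum_distrib_left using sum_mono[of A "\<lambda>_. n * d" "\<lambda>E. 2 * card (W E)"] W_ge by simp
  ultimately have "card A * (n * d) \<le> 2 * (card B * (d * d))" by linarith
  then have "d * (n * card A) \<le> d * (2 * d * card B)" by (simp add: ac_simps)
  then have "n * card A \<le> 2 * d * card B" using d by simp
  also have "\<dots> \<le> 2 * d * card {E \<in> reg n d. T \<subseteq> E}"
    unfolding B_def using finite_reg by (intro mult_left_mono card_mono) auto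
  finally have "real (n * card A) \<le> real (2 * d * card {E \<in> reg n d. T \<subseteq> E})"
    by (rule of_nat_mono)
  then show ?thesis unfolding A_def by simp
qed

text \<open>Independent entries would give (d/n)^|T|; the factor 2 per position pays for the
  dependence.\<close>

lemma card_reg_superset_le:
  assumes d: "4 \<le> d" "8 * d \<le> n" and T: "finite T" "card T \<le> n"
  shows "real (card {E \<in> reg n d. T \<subseteq> E}) \<le> (2 * real d / real n) ^ card T * real (card (reg n d))"
  using T
proof (induction T)
  case (insert e T)
  have n: "n > 0" using d by simp
  show ?case
  proof (cases "e \<in> {..<n} \<times> {..<n}")
    case True
    have "real (card {E \<in> reg n d. insert e T \<subseteq> E}) \<le> (2 * real d / real n) * real (card {E \<in> reg n d. T \<subseteq> E})"
      using card_reg_insert_le[OF d _ _ _ True, of T] insert.hyps insert.prems n by (simp add: field_simps)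
    also have "\<dots> \<le> (2 * real d / real n) * ((2 * real d / real n) ^ card T * real (card (reg n d)))"
      using insert by (intro mult_left_mono) auto
    finally show ?thesis using insert.hyps by simp
  next
    case False
    then have *: "{E \<in> reg n d. insert e T \<subseteq> E} = {}" using reg_subset by blast
    show ?thesis unfolding * by simp
  qed
qed simp

section \<open>Expansion\<close>

text \<open>With \<open>s = md\<close> and \<open>r = s/n\<close>, the factors are the number of sets \<open>I\<close> of at most \<open>3s/4\<close> rows, and the
  number of \<open>s\<close>-subsets of \<open>I \<times> J\<close> times the probability that one of them is occupied.\<close>

lemma nonexpanding_count_identity:
  fixes r :: real
  assumes r: "0 < r" "r \<le> 1" and k: "4 * k \<le> 3 * s"
  shows "(1 / r) ^ k * 3 ^ s * (9 / 2 * r) ^ s \<le> (14 ^ 4 * r) powr (real s / 4)"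
proof -
  \<comment> \<open>Choosing the rows costs at most r^(-3s/4), against r^s gained from s occupied
    positions; a threshold below 1 is what leaves the positive power s/4.\<close>
  have "(1 / r) ^ k = (1 / r) powr real k"
    using r by (simp add: powr_realpow)
  also have "\<dots> \<le> (1 / r) powr (3 * real s / 4)"
    using r k by (intro powr_mono) (auto simp: field_simps simp flip: of_nat_mult)
  also have "\<dots> = r powr (- (3 * real s / 4))"
    using r by (simp add: powr_divide powr_minus_divide)
  finally have "(1 / r) ^ k * r ^ s \<le> r powr (- (3 * real s / 4)) * r powr real s"
    using r by (simp add: powr_realpow mult_right_mono)
  also have "\<dots> = r powr (real s / 4)"
    by (simp add: powr_add[symmetric] field_simps)
  finally have 1: "(1 / r) ^ k * r ^ s \<le> r powr (real s / 4)" .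
  \<comment> \<open>Origin of \<open>14 ^ 4\<close>: the base 3 * 9/2 = 27/2 is rounded up to 14,
    and \<open>14 ^ s\<close> is moved under the exponent s/4.\<close>
  have "(14 ^ 4 :: real) powr (real s / 4) = (14 powr 4) powr (real s / 4)"
    by simp
  also have "\<dots> = 14 ^ s"
    unfolding powr_powr by (simp add: powr_realpow)
  finally have 2: "(14 ^ 4 :: real) powr (real s / 4) = 14 ^ s" .
  have "(3 :: real) ^ s * (9 / 2) ^ s = (27 / 2) ^ s"
    unfolding power_mult_distrib[symmetric] by simp
  then have "(1 / r) ^ k * 3 ^ s * (9 / 2 * r) ^ s = ((1 / r) ^ k * r ^ s) * (27 / 2) ^ s"
    unfolding power_mult_distrib[of "9 / 2" r] by (metis mult.assoc mult.commute)
  also have "\<dots> \<le> r powr (real s / 4) * 14 ^ s"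
    using r 1 by (intro mult_mono power_mono) auto
  also have "\<dots> = (14 ^ 4 * r) powr (real s / 4)"
    using r by (simp add: powr_mult 2[simplified])
  finally show ?thesis .
qed

text \<open>If \<open>J\<close> has few neighbouring rows \<open>I\<close>, then all s = md edges at
  \<open>J\<close> sit inside I \<times> J. The union bound runs over \<open>J\<close>, over
  \<open>I\<close> and over the edge set \<open>T\<close> itself, whose occupation has probability
  at most (2d/n)^s.\<close>

lemma card_nonexpanding_le:
  assumes d: "4 \<le> d" "8 * d \<le> n" and m: "0 < m" "m * d \<le> n"
  shows "real (card {E \<in> reg n d. \<exists>J \<subseteq> {..<n}. card J = m \<and> 4 * card (E\<inverse> `` J) \<le> 3 * (m * d)})
    \<le> real (n choose m) * (14 ^ 4 * (real (m * d) / real n)) powr (real (m * d) / 4) * real (card (reg n d))"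
    (is "real (card ?B) \<le> _")
proof -
  define s where "s = m * d"
  define r where "r = real s / real n"
  define k where "k = (3 * s) div 4"
  have s: "0 < s" "s \<le> n" and n: "0 < n" using d m unfolding s_def by auto
  have r: "0 < r" "r \<le> 1" using s n unfolding r_def by auto
  define Js where "Js = {J. J \<subseteq> {..<n} \<and> card J = m}"
  define Is where "Is = {I. I \<subseteq> {..<n} \<and> card I \<le> k}"
  define Ts where "Ts I J = {T. T \<subseteq> I \<times> J \<and> card T = s}" for I J :: "nat set"
  define \<A> where "\<A> = (SIGMA J:Js. SIGMA I:Is. Ts I J)"
  have finJ: "finite Js" "finite Is" unfolding Js_def Is_def by auto
  have finT: "finite (Ts I J)" if "J \<in> Js" "I \<in> Is" for I J
    using that finite_subset[of J "{..<n}"] finite_subset[of I "{..<n}"]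
    unfolding Js_def Is_def Ts_def by auto
  have cardJ: "card Js = n choose m" unfolding Js_def using n_subsets[of "{..<n}"] by simp
  have cardI: "real (card Is) \<le> (1 / r) ^ k * 3 ^ s"
  proof -
    \<comment> \<open>With weight r one has r n = s, so the exponential factor is e^s \<le>
      3^s.\<close>
    have "real (card Is) \<le> (1 / r) ^ k * exp (r * real (card {..<n}))"
      unfolding Is_def using r by (intro card_small_subsets_le) auto
    also have "exp (r * real (card {..<n})) = exp 1 ^ s"
      using n unfolding r_def by (simp add: exp_of_nat_mult[symmetric])
    also have "(1 / r) ^ k * exp 1 ^ s \<le> (1 / r) ^ k * 3 ^ s"
      using r by (intro mult_left_mono power_mono exp_le) auto
    finally show ?thesis .
  qed
  have cardT: "real (card (Ts I J)) \<le> (9 / 4 * real m) ^ s" if "J \<in> Js" "I \<in> Is" for I J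
  proof -
    have f: "finite I" "finite J"
      using that finite_subset[of _ "{..<n}"] unfolding Js_def Is_def by auto
    have J: "card J = m" and I: "4 * card I \<le> 3 * s"
      using that unfolding Js_def Is_def k_def by auto
    have "real (card (Ts I J)) = real ((card I * m) choose s)"
      unfolding Ts_def using f J by (simp add: n_subsets card_cartesian_product)
    also have "\<dots> \<le> (3 * real (card I * m) / real s) ^ s"
      by (rule binomial_le_three_pow[OF s(1)])
    also have "\<dots> \<le> (9 / 4 * real m) ^ s"
    proof (rule power_mono)
      have "4 * real (card I) \<le> 3 * real s" using I by linarith
      then have "(4 * real (card I)) * real m \<le> (3 * real s) * real m"
        by (rule mult_right_mono) simp
      then show "3 * real (card I * m) / real s \<le> 9 / 4 * real m"
        using s by (simp add: field_simps)
    qed simp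
    finally show ?thesis .
  qed
  have fin\<A>: "finite \<A>" unfolding \<A>_def using finJ finT by auto
  have "real (card \<A>) = (\<Sum>J\<in>Js. \<Sum>I\<in>Is. real (card (Ts I J)))"
    unfolding \<A>_def using finJ finT by (simp add: card_SigmaI)
  also have "\<dots> \<le> (\<Sum>J\<in>Js. \<Sum>I\<in>Is. (9 / 4 * real m) ^ s)"
    using cardT by (intro sum_mono) auto
  also have "\<dots> = real (n choose m) * (real (card Is) * (9 / 4 * real m) ^ s)"
    using cardJ by simp
  also have "\<dots> \<le> real (n choose m) * ((1 / r) ^ k * 3 ^ s * (9 / 4 * real m) ^ s)"
    using cardI by (intro mult_left_mono mult_right_mono) auto
  finally have card\<A>: "real (card \<A>) \<le> real (n choose m) * ((1 / r) ^ k * 3 ^ s * (9 / 4 * real m) ^ s)" .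
  have "real (card ?B) \<le> real (card \<A>) * ((2 * real d / real n) ^ s * real (card (reg n d)))"
  proof (rule card_le_of_cover[OF fin\<A>, where F = "\<lambda>(J, I, T). {E \<in> reg n d. T \<subseteq> E}"])
    show "?B \<subseteq> (\<Union>a\<in>\<A>. case a of (J, I, T) \<Rightarrow> {E \<in> reg n d. T \<subseteq> E})"
    proof
      fix E assume "E \<in> ?B"
      then obtain J where E: "E \<in> reg n d" and J: "J \<subseteq> {..<n}" "card J = m"
        and le: "4 * card (E\<inverse> `` J) \<le> 3 * (m * d)" by auto
      have "card (E \<inter> UNIV \<times> J) = s" using card_Int_cols[OF E J(1)] J(2) s_def by simp
      moreover have "E \<inter> UNIV \<times> J \<subseteq> (E\<inverse> `` J) \<times> J" by auto
      moreover have "E\<inverse> `` J \<in> Is"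
        unfolding Is_def k_def using le reg_Image_subset(2)[OF E] s_def by auto
      ultimately have "(J, E\<inverse> `` J, E \<inter> UNIV \<times> J) \<in> \<A>"
        unfolding \<A>_def Js_def Ts_def using J by auto
      then show "E \<in> (\<Union>a\<in>\<A>. case a of (J, I, T) \<Rightarrow> {E \<in> reg n d. T \<subseteq> E})"
        using E by (intro UN_I) auto
    qed
    fix a assume a: "a \<in> \<A>"
    obtain J I T where [simp]: "a = (J, I, T)" by (cases a)
    have T: "card T = s" using a unfolding \<A>_def Ts_def by auto
    then have "finite T" using s by (intro card_ge_0_finite) simp
    then show "real (card (case a of (J, I, T) \<Rightarrow> {E \<in> reg n d. T \<subseteq> E}))
        \<le> (2 * real d / real n) ^ s * real (card (reg n d))"
      using card_reg_superset_le[OF d] T s by auto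
  qed (use finite_reg in auto)
  also have "\<dots> \<le> (real (n choose m) * ((1 / r) ^ k * 3 ^ s * (9 / 4 * real m) ^ s))
      * ((2 * real d / real n) ^ s * real (card (reg n d)))"
    using card\<A> by (intro mult_right_mono) auto
  also have "\<dots> = real (n choose m) * ((1 / r) ^ k * 3 ^ s * (9 / 2 * r) ^ s) * real (card (reg n d))"
  proof -
    have "(9 / 4 * real m) ^ s * (2 * real d / real n) ^ s = (9 / 2 * r) ^ s"
      unfolding r_def s_def power_mult_distrib[symmetric] by (simp add: mult.commute)
    then show ?thesis by (simp add: ac_simps)
  qed
  also have "\<dots> \<le> real (n choose m) * (14 ^ 4 * r) powr (real s / 4) * real (card (reg n d))"
    using nonexpanding_count_identity[OF r, of k s]
    by (intro mult_right_mono mult_left_mono) (auto simp: k_def)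
  finally show ?thesis unfolding r_def s_def by simp
qed

text \<open>A column shared by both rows of a pair drops out of their difference, so it offers
  nothing to resample. These are the pairs where a neighbour of \<open>J\<close> may be lost in this
  way.\<close>

definition double_hits :: "nat \<Rightarrow> (nat \<times> nat) set \<Rightarrow> nat set \<Rightarrow> nat set" where
  "double_hits h E J = {i. i < h \<and> (\<exists>j\<in>J. (i, j) \<in> E \<and> (h + i, j) \<in> E)}"

text \<open>Each such pair forces two occupied positions in one column. For b pairs the probability
  (2d/n)^(2b) meets only (12n/d)^b choices of the positions in the first rows, which leaves
  (48d/n)^b.\<close>

lemma card_double_hits_ge_le:
  assumes d: "4 \<le> d" "48 * d \<le> n" and m: "0 < m" "m * d \<le> n" and h: "2 * h \<le> n"
  shows "real (card {E \<in> reg n d. \<exists>J \<subseteq> {..<n}. card J = m \<and> m * d \<le> 8 * card (double_hits h E J)})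
    \<le> real (n choose m) * (48 * (real d / real n)) powr (real (m * d) / 8) * real (card (reg n d))"
    (is "real (card ?B) \<le> _")
proof -
  define s where "s = m * d"
  \<comment> \<open>s/8 rounded up, so that b pairs are really available and still 8b \<ge>
    s.\<close>
  define b where "b = (s + 7) div 8"
  have s: "0 < s" "s \<le> n" and n: "0 < n" using d m unfolding s_def by auto
  have b: "s \<le> 8 * b" "0 < b" "2 * b \<le> n" using s d unfolding b_def by auto
  define Js where "Js = {J. J \<subseteq> {..<n} \<and> card J = m}"
  define Ys where "Ys J = {Y. Y \<subseteq> {..<h} \<times> J \<and> card Y = b}" for J :: "nat set"
  define \<A> where "\<A> = (SIGMA J:Js. Ys J)"
  define dbl where "dbl Y = Y \<union> (\<lambda>(i, j). (h + i, j)) ` Y" for Y :: "(nat \<times> nat) set"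
  have finJ: "finite Js" unfolding Js_def by auto
  have finY: "finite (Ys J)" if "J \<in> Js" for J
    using that finite_subset[of J "{..<n}"] unfolding Js_def Ys_def by auto
  have cardJ: "card Js = n choose m" unfolding Js_def using n_subsets[of "{..<n}"] by simp
  have cardY: "real (card (Ys J)) \<le> (12 * real n / real d) ^ b" if "J \<in> Js" for J
  proof -
    have J: "finite J" "card J = m"
      using that finite_subset[of _ "{..<n}"] unfolding Js_def by auto
    have "real (card (Ys J)) = real ((h * m) choose b)"
      unfolding Ys_def using J by (simp add: n_subsets card_cartesian_product)
    also have "\<dots> \<le> (3 * real (h * m) / real b) ^ b"
      by (rule binomial_le_three_pow[OF b(2)])
    also have "\<dots> \<le> (12 * real n / real d) ^ b"
    proof (rule power_mono)
      have "(2 * h) * (m * d) \<le> n * (8 * b)"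
        using h b(1) unfolding s_def by (rule mult_le_mono)
      then have "real ((2 * h) * (m * d)) \<le> real (n * (8 * b))" by (rule of_nat_mono)
      then show "3 * real (h * m) / real b \<le> 12 * real n / real d"
        using b(2) d by (simp add: field_simps)
    qed simp
    finally show ?thesis .
  qed
  have fin\<A>: "finite \<A>" unfolding \<A>_def using finJ finY by auto
  have "real (card \<A>) = (\<Sum>J\<in>Js. real (card (Ys J)))"
    unfolding \<A>_def using finJ finY by (simp add: card_SigmaI)
  also have "\<dots> \<le> (\<Sum>J\<in>Js. (12 * real n / real d) ^ b)"
    using cardY by (intro sum_mono) auto
  finally have card\<A>: "real (card \<A>) \<le> real (n choose m) * (12 * real n / real d) ^ b"
    using cardJ by simp
  have "real (card ?B) \<le> real (card \<A>) * ((2 * real d / real n) ^ (2 * b) * real (card (reg n d)))"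
  proof (rule card_le_of_cover[OF fin\<A>, where F = "\<lambda>(J, Y). {E \<in> reg n d. dbl Y \<subseteq> E}"])
    show "?B \<subseteq> (\<Union>a\<in>\<A>. case a of (J, Y) \<Rightarrow> {E \<in> reg n d. dbl Y \<subseteq> E})"
    proof
      fix E assume "E \<in> ?B"
      then obtain J where E: "E \<in> reg n d" and J: "J \<subseteq> {..<n}" "card J = m"
        and le: "m * d \<le> 8 * card (double_hits h E J)" by auto
      have "b \<le> card (double_hits h E J)" using le unfolding b_def s_def by linarith
      then obtain D where D: "D \<subseteq> double_hits h E J" "card D = b" "finite D"
        by (rule obtain_subset_with_card_n)
      have "\<forall>i\<in>D. \<exists>j. j \<in> J \<and> (i, j) \<in> E \<and> (h + i, j) \<in> E"
        using D(1) unfolding double_hits_def by blast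
      from bchoice[OF this] obtain f
        where f: "\<And>i. i \<in> D \<Longrightarrow> f i \<in> J \<and> (i, f i) \<in> E \<and> (h + i, f i) \<in> E" by blast
      define Y where "Y = (\<lambda>i. (i, f i)) ` D"
      have "card Y = b" unfolding Y_def using D by (subst card_image) (auto intro: inj_onI)
      moreover have "Y \<subseteq> {..<h} \<times> J" using f D(1) unfolding Y_def double_hits_def by auto
      ultimately have "(J, Y) \<in> \<A>" unfolding \<A>_def Js_def Ys_def using J by auto
      moreover have "dbl Y \<subseteq> E" unfolding dbl_def Y_def using f by auto
      ultimately show "E \<in> (\<Union>a\<in>\<A>. case a of (J, Y) \<Rightarrow> {E \<in> reg n d. dbl Y \<subseteq> E})"
        using E by (intro UN_I) auto
    qed
    fix a assume a: "a \<in> \<A>"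
    obtain J Y where [simp]: "a = (J, Y)" by (cases a)
    have Y: "card Y = b" "Y \<subseteq> {..<h} \<times> J" using a unfolding \<A>_def Ys_def by auto
    have fY: "finite Y" using Y(1) b by (intro card_ge_0_finite) simp
    have "card (dbl Y) = card Y + card ((\<lambda>(i, j). (h + i, j)) ` Y)"
      unfolding dbl_def using Y(2) fY by (intro card_Un_disjoint) auto
    also have "card ((\<lambda>(i, j). (h + i, j)) ` Y) = card Y"
      by (rule card_image) (auto intro: inj_onI)
    finally have cd: "card (dbl Y) = 2 * b" using Y(1) by simp
    have "finite (dbl Y)" unfolding dbl_def using fY by simp
    from card_reg_superset_le[OF d(1) _ this, of n] show
      "real (card (case a of (J, Y) \<Rightarrow> {E \<in> reg n d. dbl Y \<subseteq> E}))
        \<le> (2 * real d / real n) ^ (2 * b) * real (card (reg n d))"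
      using b(3) d(2) by (simp add: cd)
  qed (use finite_reg in auto)
  also have "\<dots> \<le> (real (n choose m) * (12 * real n / real d) ^ b)
      * ((2 * real d / real n) ^ (2 * b) * real (card (reg n d)))"
    using card\<A> by (intro mult_right_mono) auto
  also have "\<dots> = real (n choose m) * (48 * (real d / real n)) ^ b * real (card (reg n d))"
  proof -
    have "(12 * real n / real d) ^ b * (2 * real d / real n) ^ (2 * b) = (48 * (real d / real n)) ^ b"
      unfolding power_mult power_mult_distrib[symmetric] using n d
      by (simp add: power2_eq_square)
    then show ?thesis by (simp add: ac_simps)
  qed
  also have "\<dots> \<le> real (n choose m) * (48 * (real d / real n)) powr (real (m * d) / 8) * real (card (reg n d))"
  proof (intro mult_right_mono mult_left_mono)
    have "(48 * (real d / real n)) ^ b = (48 * (real d / real n)) powr real b"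
      using n d by (simp add: powr_realpow)
    also have "\<dots> \<le> (48 * (real d / real n)) powr (real (m * d) / 8)"
    proof (rule powr_mono')
      have "real s \<le> real (8 * b)" using b(1) by (rule of_nat_mono)
      then show "real (m * d) / 8 \<le> real b" unfolding s_def by simp
      have "real (48 * d) \<le> real n" using d(2) by (rule of_nat_mono)
      then show "48 * (real d / real n) \<le> 1" using n by simp
    qed simp
    finally show "(48 * (real d / real n)) ^ b \<le> (48 * (real d / real n)) powr (real (m * d) / 8)" .
  qed auto
  finally show ?thesis .
qed

text \<open>If every neighbouring row met \<open>J\<close> at least twice, the d|J| edges at
  \<open>J\<close> would reach at most d|J|/2 rows.\<close>

lemma unique_neighbour_exists:
  assumes E: "E \<in> reg n d" and J: "J \<subseteq> {..<n}" and exp: "3 * (card J * d) < 4 * card (E\<inverse> `` J)"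
  shows "\<exists>i<n. \<exists>j\<in>J. E `` {i} \<inter> J = {j}"
proof (rule ccontr)
  assume contr: "\<not> ?thesis"
  let ?N = "E\<inverse> `` J"
  have fin: "finite ?N" "finite J"
    using finite_Image_reg[OF E] finite_subset[OF J] by auto
  have two: "2 \<le> card (E `` {i} \<inter> J)" if i: "i \<in> ?N" for i
  proof -
    have "E `` {i} \<inter> J \<noteq> {}" using i by auto
    moreover have "i < n" using i reg_Image_subset(2)[OF E] by auto
    then have "card (E `` {i} \<inter> J) \<noteq> 1" using contr by (force simp: card_1_singleton_iff)
    ultimately show ?thesis using fin by (cases "card (E `` {i} \<inter> J)") auto
  qed
  have "E \<inter> UNIV \<times> J = (SIGMA i:?N. E `` {i} \<inter> J)" by auto
  then have "card J * d = (\<Sum>i\<in>?N. card (E `` {i} \<inter> J))"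
    using card_Int_cols[OF E J] fin by simp
  moreover have "(\<Sum>i\<in>?N. 2) \<le> (\<Sum>i\<in>?N. card (E `` {i} \<inter> J))"
    using two by (rule sum_mono)
  ultimately show False using exp by simp
qed

definition row_diff :: "nat \<Rightarrow> (nat \<times> nat) set \<Rightarrow> nat \<Rightarrow> nat set" where
  "row_diff h E i = (E `` {i} - E `` {h + i}) \<union> (E `` {h + i} - E `` {i})"

lemma card_pairs_hit_ge:
  assumes E: "E \<in> reg n d" and J: "J \<subseteq> {..<n}"
    and exp: "3 * (card J * d) < 4 * card (E\<inverse> `` J)"
    and dbl: "8 * card (double_hits (n div 2) E J) < card J * d"
    and s: "4 \<le> card J * d"
  shows "card J * d \<le> 8 * card {i. i < n div 2 \<and> row_diff (n div 2) E i \<inter> J \<noteq> {}}"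
proof -
  let ?h = "n div 2"
  let ?G = "{i. i < ?h \<and> row_diff ?h E i \<inter> J \<noteq> {}}" and ?D = "double_hits ?h E J"
  have finG: "finite ?G" "finite ?D" unfolding double_hits_def by auto
  \<comment> \<open>The last singleton is the row left unpaired when n is odd.\<close>
  have "E\<inverse> `` J \<subseteq> ?G \<union> (+) ?h ` ?G \<union> (?D \<union> (+) ?h ` ?D) \<union> {2 * ?h}"
  proof
    fix i assume i: "i \<in> E\<inverse> `` J"
    then obtain j where j: "(i, j) \<in> E" "j \<in> J" by auto
    have "i < n" using i reg_Image_subset(2)[OF E] by auto
    then consider "i < ?h" | "?h \<le> i" "i - ?h < ?h" | "i = 2 * ?h" by linarith
    then show "i \<in> ?G \<union> (+) ?h ` ?G \<union> (?D \<union> (+) ?h ` ?D) \<union> {2 * ?h}"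
    proof cases
      case 1
      then show ?thesis using j unfolding row_diff_def double_hits_def by auto
    next
      case 2
      then have "i - ?h \<in> ?G \<union> ?D" using j unfolding row_diff_def double_hits_def by auto
      moreover have "i = ?h + (i - ?h)" using 2 by simp
      ultimately show ?thesis by blast
    qed auto
  qed
  then have "card (E\<inverse> `` J) \<le> card (?G \<union> (+) ?h ` ?G \<union> (?D \<union> (+) ?h ` ?D) \<union> {2 * ?h})"
    using finG by (intro card_mono) auto
  also have "\<dots> \<le> card ?G + card ((+) ?h ` ?G) + (card ?D + card ((+) ?h ` ?D)) + card {2 * ?h}"
    by (intro order.trans[OF card_Un_le] add_mono order.refl)
  also have "card ((+) ?h ` ?G) = card ?G" by (simp add: card_image)
  also have "card ((+) ?h ` ?D) = card ?D" by (simp add: card_image)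
  finally have "card (E\<inverse> `` J) \<le> 2 * card ?G + 2 * card ?D + 1" by simp
  \<comment> \<open>With s = \<open>card J * d\<close> this reads 3s/4 < 2 \<open>card ?G\<close> +
    s/4 + 1, and s/2 - 1 \<ge> s/4 because s \<ge> 4.\<close>
  then show ?thesis using exp dbl s by linarith
qed

text \<open>Two rows of size d that cover more than 3d/2 columns share fewer than d/2.\<close>

lemma card_row_diff_ge:
  assumes E: "E \<in> reg n d" and i: "h + i < n"
    and exp: "3 * (2 * d) < 4 * card (E `` {i, h + i})"
  shows "d \<le> card (row_diff h E i)"
proof -
  let ?A = "E `` {i}" and ?B = "E `` {h + i}"
  have fin: "finite ?A" "finite ?B" using finite_Image_reg(1)[OF E] by auto
  have "card (?A \<union> ?B) = card (row_diff h E i) + card (?A \<inter> ?B)"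
    unfolding row_diff_def using fin by (subst card_Un_disjoint[symmetric]) (auto intro: arg_cong[where f = card])
  moreover have "card ?A + card ?B = card (?A \<union> ?B) + card (?A \<inter> ?B)"
    using fin by (rule card_Un_Int)
  moreover have "E `` {i, h + i} = ?A \<union> ?B" by auto
  ultimately show ?thesis using exp reg_row[OF E, of i] reg_row[OF E i] i by simp
qed

section \<open>Resampling pairs of rows\<close>

text \<open>The rank of a family of rows is at most the number of unknowns. Gaussian elimination
  proves it: a pivot row \<open>i0\<close> with nonzero coefficient at \<open>q\<close> removes that
  unknown from all other rows and is added to the selection.\<close>

lemma determining_rows:
  fixes r :: "'i \<Rightarrow> 'k \<Rightarrow> real"
  assumes "finite K"
  shows "\<exists>I' \<subseteq> I. finite I' \<and> card I' \<le> card K \<and>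
    (\<forall>y. (\<forall>i\<in>I'. (\<Sum>k\<in>K. r i k * y k) = 0) \<longrightarrow> (\<forall>i\<in>I. (\<Sum>k\<in>K. r i k * y k) = 0))"
  using assms
proof (induction K arbitrary: r)
  case empty
  show ?case by (intro exI[of _ "{}"]) auto
next
  case (insert q K)
  show ?case
  proof (cases "\<forall>i\<in>I. r i q = 0")
    case True
    obtain I' where I': "I' \<subseteq> I" "finite I'" "card I' \<le> card K"
      and y: "\<And>y. (\<forall>i\<in>I'. (\<Sum>k\<in>K. r i k * y k) = 0) \<Longrightarrow> \<forall>i\<in>I. (\<Sum>k\<in>K. r i k * y k) = 0"
      using insert.IH[of r] by blast
    have "(\<Sum>k\<in>insert q K. r i k * y k) = (\<Sum>k\<in>K. r i k * y k)" if "i \<in> I" for i and y :: "'k \<Rightarrow> real"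
      using insert.hyps True that by simp
    note eq = this
    show ?thesis
    proof (intro exI[of _ I'] conjI allI impI ballI)
      fix z i assume z: "\<forall>i\<in>I'. (\<Sum>k\<in>insert q K. r i k * z k) = 0" and i: "i \<in> I"
      have "\<forall>i\<in>I'. (\<Sum>k\<in>K. r i k * z k) = 0"
      proof
        fix i assume "i \<in> I'"
        then show "(\<Sum>k\<in>K. r i k * z k) = 0" using z eq[of i z] I'(1) by (metis subsetD)
      qed
      from y[OF this] show "(\<Sum>k\<in>insert q K. r i k * z k) = 0" using eq[OF i] i by metis
    qed (use I' insert.hyps in auto)
  next
    case False
    then obtain i0 where i0: "i0 \<in> I" "r i0 q \<noteq> 0" by blast
    define r' where "r' i k = r i k - (r i q / r i0 q) * r i0 k" for i k
    obtain I' where I': "I' \<subseteq> I" "finite I'" "card I' \<le> card K"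
      and y: "\<And>y. (\<forall>i\<in>I'. (\<Sum>k\<in>K. r' i k * y k) = 0) \<Longrightarrow> \<forall>i\<in>I. (\<Sum>k\<in>K. r' i k * y k) = 0"
      using insert.IH[of r'] by blast
    have elim: "(\<Sum>k\<in>insert q K. r i k * y k) = (\<Sum>k\<in>K. r' i k * y k)"
      if "(\<Sum>k\<in>insert q K. r i0 k * y k) = 0" for i and y :: "'k \<Rightarrow> real"
    proof -
      have "(\<Sum>k\<in>insert q K. r i k * y k)
          = (\<Sum>k\<in>insert q K. r i k * y k) - (r i q / r i0 q) * (\<Sum>k\<in>insert q K. r i0 k * y k)"
        using that by simp
      also have "\<dots> = (\<Sum>k\<in>insert q K. r' i k * y k)"
        unfolding r'_def by (simp only: sum_distrib_left sum_subtractf[symmetric] left_diff_distrib mult.assoc)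
      also have "\<dots> = (\<Sum>k\<in>K. r' i k * y k)"
        using insert.hyps i0 by (simp add: r'_def)
      finally show ?thesis .
    qed
    show ?thesis
    proof (intro exI[of _ "insert i0 I'"] conjI allI impI)
      show "insert i0 I' \<subseteq> I" "finite (insert i0 I')" using I' i0 by auto
      show "card (insert i0 I') \<le> card (insert q K)"
        using I' insert.hyps by (simp add: card_insert_if)
      fix z assume z: "\<forall>i\<in>insert i0 I'. (\<Sum>k\<in>insert q K. r i k * z k) = 0"
      then have z0: "(\<Sum>k\<in>insert q K. r i0 k * z k) = 0" by blast
      have "\<forall>i\<in>I'. (\<Sum>k\<in>K. r' i k * z k) = 0"
        using z elim[OF z0] by simp
      from y[OF this] show "\<forall>i\<in>I. (\<Sum>k\<in>insert q K. r i k * z k) = 0"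
        unfolding elim[OF z0] .
    qed
  qed
qed

section \<open>Random halves of a set\<close>

definition halves :: "'a set \<Rightarrow> 'a set set" where
  "halves S = {A. A \<subseteq> S \<and> 2 * card A = card S}"

lemma finite_halves: "finite S \<Longrightarrow> finite (halves S)"
  unfolding halves_def by simp

text \<open>Adding \<open>a\<close> to any t-subset of the 2t remaining elements gives a half of the
  required kind, and the central binomial coefficient grows by a factor of at most 4 from t to t +
  1.\<close>

lemma card_halves_separating:
  assumes S: "finite S" and j: "a \<in> S" "b \<in> S" "a \<noteq> b"
  shows "card (halves S) \<le> 4 * card {A \<in> halves S. a \<in> A \<and> b \<notin> A}"
proof (cases "even (card S)")
  case False
  have "2 * card A \<noteq> card S" for A :: "'a set"
    using False by (metis dvd_triv_left)
  then have "halves S = {}" unfolding halves_def by simp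
  then show ?thesis by simp
next
  case True
  have "card {a, b} \<le> card S" using S j by (intro card_mono) auto
  then have "2 \<le> card S" using j by simp
  moreover obtain u where "card S = 2 * u" using True by blast
  ultimately obtain t where t: "card S = 2 * Suc t" by (cases u) auto
  let ?S' = "S - {a, b}"
  have S': "finite ?S'" "card ?S' = 2 * t" using S j t by (auto simp: card_Diff_subset)
  have "card {A. A \<subseteq> ?S' \<and> card A = t} \<le> card {A \<in> halves S. a \<in> A \<and> b \<notin> A}"
  proof (rule card_inj_on_le[where f = "insert a"])
    show "inj_on (insert a) {A. A \<subseteq> ?S' \<and> card A = t}"
      by (rule inj_onI) blast
    show "insert a ` {A. A \<subseteq> ?S' \<and> card A = t} \<subseteq> {A \<in> halves S. a \<in> A \<and> b \<notin> A}"
    proof clarify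
      fix A assume A: "A \<subseteq> ?S'" "t = card A"
      then have "finite A" "a \<notin> A" using S finite_subset by auto
      then have "card (insert a A) = Suc t" using A by simp
      then show "insert a A \<in> halves S \<and> a \<in> insert a A \<and> b \<notin> insert a A"
        unfolding halves_def using A j t by auto
    qed
    show "finite {A \<in> halves S. a \<in> A \<and> b \<notin> A}" using finite_halves[OF S] by simp
  qed
  then have "(2 * t) choose t \<le> card {A \<in> halves S. a \<in> A \<and> b \<notin> A}"
    using n_subsets[OF S'(1), of t] S'(2) by simp
  moreover have "halves S = {A. A \<subseteq> S \<and> card A = Suc t}"
    unfolding halves_def t by auto
  then have "card (halves S) = (2 * Suc t) choose (Suc t)"
    using n_subsets[OF S, of "Suc t"] t by simp
  moreover have "(2 * Suc t) choose (Suc t) \<le> 4 * ((2 * t) choose t)"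
  proof -
    have "(2 * Suc t) choose (Suc t) = (Suc (2 * t) choose t) + (Suc (2 * t) choose Suc t)" by simp
    also have "Suc (2 * t) choose t = Suc (2 * t) choose Suc t"
      by (subst binomial_symmetric) auto
    also have "Suc (2 * t) choose Suc t = (2 * t choose t) + (2 * t choose Suc t)" by simp
    also have "2 * t choose Suc t \<le> 2 * t choose t" by (rule binomial_maximum')
    finally show ?thesis by simp
  qed
  ultimately show ?thesis by simp
qed

text \<open>Exchanging \<open>a\<close> and \<open>b\<close> changes the sum over a half containing exactly one of them, so at
  most one of the two halves attains the value \<open>\<tau>\<close>.\<close>

lemma card_halves_sum_eq_le:
  fixes x :: "'a \<Rightarrow> real"
  assumes S: "finite S" and j: "a \<in> S" "b \<in> S" and x: "x a \<noteq> x b"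
  shows "real (card {A \<in> halves S. sum x A = \<tau>}) \<le> 3 / 4 * real (card (halves S))"
proof -
  let ?H = "halves S"
  let ?U = "{A \<in> ?H. a \<in> A \<and> b \<notin> A}"
  let ?swap = "\<lambda>A. insert b (A - {a})"
  \<comment> \<open>\<open>?g\<close> repairs the halves that attain \<open>\<tau>\<close> and
    leaves the others alone. Repaired sets contain \<open>b\<close> but not \<open>a\<close>,
    untouched ones the reverse, so no two images collide.\<close>
  let ?g = "\<lambda>A. if sum x A = \<tau> then ?swap A else A"
  have fin: "finite ?H" by (rule finite_halves[OF S])
  have finA: "finite A" if "A \<in> ?H" for A using that S finite_subset unfolding halves_def by auto
  have "card ?U \<le> card {A \<in> ?H. sum x A \<noteq> \<tau>}"
  proof (rule card_inj_on_le[where f = ?g])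
    show "inj_on ?g ?U"
    proof (rule inj_onI)
      fix A B assume AB: "A \<in> ?U" "B \<in> ?U" and eq: "?g A = ?g B"
      have ab: "a \<noteq> b" using x by auto
      have inv: "C = insert a (?swap C - {b})" if "C \<in> ?U" for C
        using that ab by auto
      have swap: "?swap C \<noteq> D" if "C \<in> ?U" "D \<in> ?U" for C D
        using that by auto
      consider "?swap A = ?swap B" | "A = B" | "?swap A = B" | "A = ?swap B"
        using eq by metis
      then show "A = B"
      proof cases
        case 1
        then show ?thesis using inv[OF AB(1)] inv[OF AB(2)] by simp
      qed (use swap[OF AB] swap[OF AB(2,1)] in simp_all)
    qed
    show "?g ` ?U \<subseteq> {A \<in> ?H. sum x A \<noteq> \<tau>}"
    proof clarify
      fix A assume A: "A \<in> ?H" "a \<in> A" "b \<notin> A"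
      have "card (?swap A) = card A"
        using card_swap_element[OF finA[OF A(1)] A(2,3)] .
      then have "?swap A \<in> ?H" using A j unfolding halves_def by auto
      moreover have "sum x (?swap A) = sum x A - x a + x b"
        using finA[OF A(1)] A by (simp add: sum_diff1)
      ultimately show "?g A \<in> ?H \<and> sum x (?g A) \<noteq> \<tau>"
        using A x by auto
    qed
    show "finite {A \<in> ?H. sum x A \<noteq> \<tau>}" using fin by simp
  qed
  moreover have "card ?H = card {A \<in> ?H. sum x A = \<tau>} + card {A \<in> ?H. sum x A \<noteq> \<tau>}"
    using fin by (subst card_Un_disjoint[symmetric]) (auto intro: arg_cong[where f = card])
  moreover have "card ?H \<le> 4 * card ?U"
    using card_halves_separating[OF S j] x by blast
  ultimately have "4 * card {A \<in> ?H. sum x A = \<tau>} \<le> 3 * card ?H" by linarith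
  then have "real (4 * card {A \<in> ?H. sum x A = \<tau>}) \<le> real (3 * card ?H)" by (rule of_nat_mono)
  then show ?thesis by simp
qed

text \<open>Conditioning on the coordinates in \<open>P\<close>, in counting form: the values
  allowed elsewhere are given by \<open>W\<close> as a function of the restriction to
  \<open>P\<close> alone, so each fibre lies in a product. \<open>Q\<close> records what is known
  about that restriction.\<close>

lemma card_PiE_split_le:
  fixes \<epsilon> :: real
  assumes H: "finite H" "P \<subseteq> H" and \<Omega>: "\<And>i. i \<in> H \<Longrightarrow> finite (\<Omega> i)"
    and B: "B \<subseteq> PiE H \<Omega>" and Q: "\<And>f. f \<in> B \<Longrightarrow> Q (restrict f P)"
    and W: "\<And>f i. f \<in> B \<Longrightarrow> i \<in> H - P \<Longrightarrow> f i \<in> W (restrict f P) i"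
    and W_sub: "\<And>g i. i \<in> H - P \<Longrightarrow> W g i \<subseteq> \<Omega> i"
    and le: "\<And>g. g \<in> PiE P \<Omega> \<Longrightarrow> Q g \<Longrightarrow>
      (\<Prod>i\<in>H - P. real (card (W g i))) \<le> \<epsilon> * (\<Prod>i\<in>H - P. real (card (\<Omega> i)))"
    and \<epsilon>: "0 \<le> \<epsilon>"
  shows "real (card B) \<le> \<epsilon> * real (card (PiE H \<Omega>))"
proof -
  let ?G = "{g \<in> PiE P \<Omega>. Q g}"
  let ?split = "\<lambda>f. (restrict f P, restrict f (H - P))"
  have finP: "finite P" using H finite_subset by auto
  have fin\<Omega>P: "finite (PiE P \<Omega>)" using finP H \<Omega> by (intro finite_PiE) auto
  have finW: "finite (W g i)" if "i \<in> H - P" for g i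
    by (rule finite_subset[OF W_sub[OF that]]) (use \<Omega> that in auto)
  have finR: "finite (PiE (H - P) (W g))" for g
    using H finW by (intro finite_PiE) auto
  have "card B \<le> card (SIGMA g:?G. PiE (H - P) (W g))"
  proof (rule card_inj_on_le[where f = ?split])
    show "inj_on ?split B"
    proof (rule inj_onI)
      fix f f' assume f: "f \<in> B" "f' \<in> B" and eq: "?split f = ?split f'"
      show "f = f'"
      proof (rule PiE_ext)
        show "f \<in> PiE H \<Omega>" "f' \<in> PiE H \<Omega>" using f B by auto
        fix i assume i: "i \<in> H"
        have "restrict f P i = restrict f' P i" "restrict f (H - P) i = restrict f' (H - P) i"
          using eq by auto
        then show "f i = f' i" using i by (cases "i \<in> P") auto
      qed
    qed
    show "?split ` B \<subseteq> (SIGMA g:?G. PiE (H - P) (W g))"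
    proof
      fix s assume "s \<in> ?split ` B"
      then obtain f where f: "f \<in> B" and s: "s = ?split f" by blast
      have "restrict f P \<in> PiE P \<Omega>" using f B H(2) by (auto simp: PiE_iff subset_iff)
      moreover have "restrict f (H - P) \<in> PiE (H - P) (W (restrict f P))"
        using W[OF f] by (auto simp: PiE_iff)
      ultimately show "s \<in> (SIGMA g:?G. PiE (H - P) (W g))"
        using Q[OF f] s by blast
    qed
    show "finite (SIGMA g:?G. PiE (H - P) (W g))" using fin\<Omega>P finR by auto
  qed
  also have "\<dots> = (\<Sum>g\<in>?G. card (PiE (H - P) (W g)))"
    using fin\<Omega>P finR by (intro card_SigmaI) auto
  finally have "real (card B) \<le> (\<Sum>g\<in>?G. real (card (PiE (H - P) (W g))))"
    by (metis of_nat_mono of_nat_sum)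
  also have "\<dots> = (\<Sum>g\<in>?G. \<Prod>i\<in>H - P. real (card (W g i)))"
    using H by (simp add: card_PiE)
  also have "\<dots> \<le> (\<Sum>g\<in>?G. \<epsilon> * (\<Prod>i\<in>H - P. real (card (\<Omega> i))))"
    using le by (intro sum_mono) auto
  also have "\<dots> = real (card ?G) * (\<epsilon> * (\<Prod>i\<in>H - P. real (card (\<Omega> i))))"
    by simp
  also have "\<dots> \<le> real (card (PiE P \<Omega>)) * (\<epsilon> * (\<Prod>i\<in>H - P. real (card (\<Omega> i))))"
    using fin\<Omega>P \<epsilon> by (intro mult_right_mono of_nat_mono card_mono mult_nonneg_nonneg prod_nonneg) auto
  also have "\<dots> = \<epsilon> * real (card (PiE H \<Omega>))"
    using H finP prod.subset_diff[OF H(2,1), of "\<lambda>i. real (card (\<Omega> i))"]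
    by (simp add: card_PiE)
  finally show ?thesis .
qed

text \<open>\<open>K\<close> is the part common to the two rows of a pair, \<open>S\<close> their
  symmetric difference, \<open>f\<close> the share of \<open>S\<close> given to the first row, and
  \<open>L\<close> supplies the rows outside all pairs.\<close>

definition resampled_row :: "nat \<Rightarrow> (nat \<Rightarrow> nat set) \<Rightarrow> (nat \<Rightarrow> nat set) \<Rightarrow> (nat \<Rightarrow> nat set) \<Rightarrow> (nat \<Rightarrow> nat set) \<Rightarrow> nat \<Rightarrow> nat set" where
  "resampled_row h S K L f i = (if i < h then K i \<union> f i
     else if i < 2 * h then K (i - h) \<union> (S (i - h) - f (i - h)) else L i)"

text \<open>The rows meeting a set \<open>P\<close> of at most \<open>k + 1\<close> pairs already determine the kernel among the vectors
  that are constant off \<open>J\<close>. A kernel vector chosen as a function of these rows alone is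
  independent of the remaining pairs.\<close>

lemma card_kernel_halves_le:
  fixes S K L :: "nat \<Rightarrow> nat set" and n h k g m :: nat
  defines "\<Phi> \<equiv> PiE {..<h} (\<lambda>i. halves (S i))"
  assumes h: "2 * h \<le> n"
    and sub: "\<And>i. S i \<subseteq> {..<n}" "\<And>i. K i \<subseteq> {..<n}" "\<And>i. L i \<subseteq> {..<n}"
    and disj: "\<And>i. S i \<inter> K i = {}"
    and good: "\<And>J. J \<subseteq> {..<n} \<Longrightarrow> m \<le> card J \<Longrightarrow> card J \<le> k \<Longrightarrow>
      g \<le> card {i. i < h \<and> S i \<inter> J \<noteq> {} \<and> \<not> S i \<subseteq> J}"
  shows "real (card {f \<in> \<Phi>. \<exists>(x :: nat \<Rightarrow> real) a. m \<le> card {j. j < n \<and> x j \<noteq> a} \<and> card {j. j < n \<and> x j \<noteq> a} \<le> k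
      \<and> (\<forall>i<n. sum x (resampled_row h S K L f i) = 0)})
    \<le> real (card {J. J \<subseteq> {..<n} \<and> card J \<le> k}) * real (card {P. P \<subseteq> {..<h} \<and> card P \<le> k + 1})
      * ((3 / 4) ^ (g - (k + 1)) * real (card \<Phi>))"
    (is "real (card ?B) \<le> _")
proof -
  define \<A> where "\<A> = {J. J \<subseteq> {..<n} \<and> m \<le> card J \<and> card J \<le> k} \<times> {P. P \<subseteq> {..<h} \<and> card P \<le> k + 1}"
  \<comment> \<open>The equations imposed involve only the unpaired rows and both rows of each pair
    in \<open>P\<close>, hence only the values of \<open>f\<close> on \<open>P\<close>.\<close>
  define V where "V J P f x \<longleftrightarrow> (\<exists>a. \<forall>j<n. x j = a \<longleftrightarrow> j \<notin> J) \<and>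
      (\<forall>i<n. 2 * h \<le> i \<or> i \<in> P \<or> h \<le> i \<and> i - h \<in> P \<longrightarrow> sum x (resampled_row h S K L f i) = 0)"
    for J P f and x :: "nat \<Rightarrow> real"
  \<comment> \<open>One fixed choice, always evaluated at \<open>restrict f P\<close>; the halves
    outside \<open>P\<close> therefore cannot influence the vector.\<close>
  define X where "X J P f = (SOME x. V J P f x)" for J P f
  \<comment> \<open>Outside \<open>P\<close> only the equation of the first row of each pair is
    retained; this already gives one independent constraint per pair.\<close>
  define F where "F J P = {f \<in> \<Phi>. (\<exists>x. V J P (restrict f P) x) \<and>
      (\<forall>i\<in>{..<h} - P. sum (X J P (restrict f P)) (K i \<union> f i) = 0)}" for J P
  have finS: "finite (S i)" "finite (K i)" "finite (L i)" for i
    by (rule finite_subset[OF sub(1)] finite_subset[OF sub(2)] finite_subset[OF sub(3)]; simp)+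
  have fin\<Omega>: "finite (halves (S i))" for i using finS finite_halves by auto
  have fin\<Phi>: "finite \<Phi>" unfolding \<Phi>_def using fin\<Omega> by (intro finite_PiE) auto
  have fin\<A>: "finite \<A>" unfolding \<A>_def by simp
  have V_restrict: "V J P (restrict f P) x \<longleftrightarrow> V J P f x" if "P \<subseteq> {..<h}" for J P f x
  proof -
    have "resampled_row h S K L (restrict f P) i = resampled_row h S K L f i"
      if "2 * h \<le> i \<or> i \<in> P \<or> h \<le> i \<and> i - h \<in> P" for i
      using that \<open>P \<subseteq> {..<h}\<close> unfolding resampled_row_def by auto
    then show ?thesis unfolding V_def by auto
  qed
  have cover: "?B \<subseteq> (\<Union>a\<in>\<A>. case a of (J, P) \<Rightarrow> F J P)"
  proof
    fix f assume "f \<in> ?B"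
    then obtain x :: "nat \<Rightarrow> real" and a where f: "f \<in> \<Phi>" and x0: "\<And>i. i < n \<Longrightarrow> sum x (resampled_row h S K L f i) = 0"
      and J0: "m \<le> card {j. j < n \<and> x j \<noteq> a}" "card {j. j < n \<and> x j \<noteq> a} \<le> k" by auto
    define J where "J = {j. j < n \<and> x j \<noteq> a}"
    have J: "J \<subseteq> {..<n}" "finite J" "n \<notin> J" "m \<le> card J" "card J \<le> k"
      unfolding J_def using J0 by auto
    define R where "R = resampled_row h S K L f"
    have "f i \<subseteq> S i" if "i < h" for i
      using f that unfolding \<Phi>_def halves_def by (auto simp: PiE_iff)
    then have R: "R i \<subseteq> {..<n}" for i
      using sub unfolding R_def resampled_row_def by (auto; blast)
    have finR: "finite (R i)" for i by (rule finite_subset[OF R]) simp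
    \<comment> \<open>The index \<open>n\<close>, which is not in \<open>J\<close>, serves as an
      extra unknown for the common value off \<open>J\<close>; its coefficient counts the entries of
      the row outside \<open>J\<close>. This reduces the system to \<open>card J + 1\<close>
      unknowns.\<close>
    define r where "r i q = (if q = n then real (card (R i - J)) else of_bool (q \<in> R i))" for i q
    have r: "(\<Sum>q\<in>insert n J. r i q * (if q = n then b else z q)) = sum z (R i)"
      if z: "\<And>j. j < n \<Longrightarrow> j \<notin> J \<Longrightarrow> z j = b" for i b and z :: "nat \<Rightarrow> real"
    proof -
      have "(\<Sum>q\<in>insert n J. r i q * (if q = n then b else z q))
          = real (card (R i - J)) * b + (\<Sum>q\<in>J. r i q * (if q = n then b else z q))"
        using J by (simp add: r_def)
      also have "(\<Sum>q\<in>J. r i q * (if q = n then b else z q)) = (\<Sum>q\<in>J. if q \<in> R i then z q else 0)"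
        using J(3) by (intro sum.cong) (auto simp: r_def)
      also have "\<dots> = sum z (R i \<inter> J)"
        using J(2) by (simp add: sum.inter_restrict Int_commute)
      also have "real (card (R i - J)) * b = sum z (R i - J)"
        using z R[of i] by (subst sum.cong[OF refl, of _ z "\<lambda>_. b"]) auto
      also have "sum z (R i - J) + sum z (R i \<inter> J) = sum z (R i)"
        using finR by (subst sum.union_disjoint[symmetric]) (auto intro!: arg_cong2[where f = sum])
      finally show ?thesis .
    qed
    obtain I where I: "I \<subseteq> {..<n}" "finite I" "card I \<le> card (insert n J)"
      and det: "\<And>y. (\<forall>i\<in>I. (\<Sum>q\<in>insert n J. r i q * y q) = 0) \<Longrightarrow>
        \<forall>i\<in>{..<n}. (\<Sum>q\<in>insert n J. r i q * y q) = 0"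
      using determining_rows[of "insert n J" "{..<n}" r] J(2) by blast
    define P where "P = {i. i < h \<and> (i \<in> I \<or> h + i \<in> I)}"
    have "P \<subseteq> (\<lambda>i. if i < h then i else i - h) ` I"
    proof
      fix i assume "i \<in> P"
      then consider "i < h" "i \<in> I" | "i < h" "h + i \<in> I" unfolding P_def by auto
      then show "i \<in> (\<lambda>i. if i < h then i else i - h) ` I"
      proof cases
        case 1 then show ?thesis by (intro image_eqI[of _ _ i]) auto
      next
        case 2 then show ?thesis by (intro image_eqI[of _ _ "h + i"]) auto
      qed
    qed
    then have "card P \<le> card I" using I(2) by (rule surj_card_le[rotated])
    then have P: "P \<subseteq> {..<h}" "card P \<le> k + 1"
      using I(3) J unfolding P_def by auto
    have Vx: "V J P f x" unfolding V_def using x0 by (auto simp: J_def)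
    then have ex: "\<exists>x. V J P (restrict f P) x" using V_restrict[OF P(1)] by blast
    \<comment> \<open>\<open>z\<close> need not be the given \<open>x\<close>. It is constant off
      the same \<open>J\<close> and vanishes on the determining rows, so it lies in the kernel of
      the whole matrix.\<close>
    define z where "z = X J P (restrict f P)"
    have "V J P (restrict f P) z" unfolding z_def X_def using ex by (rule someI_ex)
    then have Vz: "V J P f z" using V_restrict[OF P(1)] by blast
    then obtain b where b: "\<And>j. j < n \<Longrightarrow> z j = b \<longleftrightarrow> j \<notin> J" unfolding V_def by blast
    have zI: "sum z (R i) = 0" if "i \<in> I" for i
    proof -
      have i: "i < n" using that I by auto
      have "2 * h \<le> i \<or> i \<in> P \<or> h \<le> i \<and> i - h \<in> P"
        using that unfolding P_def by (auto simp: not_le)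
      then show ?thesis using Vz i unfolding V_def R_def by blast
    qed
    have "\<forall>i\<in>I. (\<Sum>q\<in>insert n J. r i q * (if q = n then b else z q)) = 0"
      using r[of z b] b zI by auto
    from det[OF this] have "\<forall>i\<in>{..<n}. sum z (R i) = 0"
      using r[of z b] b by auto
    then have "sum z (K i \<union> f i) = 0" if "i \<in> {..<h} - P" for i
      using that h unfolding R_def resampled_row_def by (auto dest!: bspec[of _ _ i])
    then have "f \<in> F J P"
      unfolding F_def z_def using f ex by (intro CollectI conjI ballI)
    moreover have "(J, P) \<in> \<A>" unfolding \<A>_def using J P by auto
    ultimately show "f \<in> (\<Union>a\<in>\<A>. case a of (J, P) \<Rightarrow> F J P)" by (intro UN_I) auto
  qed
  have F_le: "real (card (F J P)) \<le> (3 / 4) ^ (g - (k + 1)) * real (card \<Phi>)"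
    if JP: "(J, P) \<in> \<A>" for J P
  proof -
    have J: "J \<subseteq> {..<n}" "m \<le> card J" "card J \<le> k" and P: "P \<subseteq> {..<h}" "card P \<le> k + 1"
      using JP unfolding \<A>_def by auto
    define W where "W q i = {A \<in> halves (S i). sum (X J P q) (K i \<union> A) = 0}" for q i
    \<comment> \<open>On these pairs the difference meets both \<open>J\<close> and its complement,
      so \<open>z\<close> takes two different values there. Removing \<open>P\<close> loses at most
      \<open>k + 1\<close> of them.\<close>
    define G where "G = {i. i < h \<and> S i \<inter> J \<noteq> {} \<and> \<not> S i \<subseteq> J}"
    have G: "G - P \<subseteq> {..<h} - P" "finite (G - P)" unfolding G_def by auto
    have "g - (k + 1) \<le> card G - card P"
      using good[OF J] P(2) unfolding G_def by linarith
    also have "\<dots> \<le> card (G - P)"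
      by (rule diff_card_le_card_Diff) (rule finite_subset[OF P(1)], simp)
    finally have cardG: "g - (k + 1) \<le> card (G - P)" .
    show ?thesis unfolding \<Phi>_def
    proof (rule card_PiE_split_le[where P = P and Q = "\<lambda>q. \<exists>x. V J P q x" and W = W])
      fix q assume q: "\<exists>x. V J P q x"
      define z where "z = X J P q"
      have "V J P q z" unfolding z_def X_def using q by (rule someI_ex)
      then obtain b where b: "\<And>j. j < n \<Longrightarrow> z j = b \<longleftrightarrow> j \<notin> J" unfolding V_def by blast
      have W_le: "real (card (W q i)) \<le> (if i \<in> G - P then 3 / 4 else 1) * real (card (halves (S i)))" for i
      proof (cases "i \<in> G - P")
        case True
        then obtain u v where uv: "u \<in> S i" "u \<in> J" "v \<in> S i" "v \<notin> J" unfolding G_def by blast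
        then have "z u \<noteq> z v" using b[of u] b[of v] sub(1)[of i] by auto
        from card_halves_sum_eq_le[OF finS(1) uv(1,3) this, of "- sum z (K i)"]
        have "real (card {A \<in> halves (S i). sum z A = - sum z (K i)}) \<le> 3 / 4 * real (card (halves (S i)))" .
        moreover have "W q i \<subseteq> {A \<in> halves (S i). sum z A = - sum z (K i)}"
        proof
          fix A assume A: "A \<in> W q i"
          then have AS: "A \<subseteq> S i" unfolding W_def halves_def by auto
          have "sum z (K i \<union> A) = sum z (K i) + sum z A"
            using AS disj[of i] finS finite_subset[OF AS] by (intro sum.union_disjoint) auto
          then show "A \<in> {A \<in> halves (S i). sum z A = - sum z (K i)}"
            using A unfolding W_def z_def by auto
        qed
        then have "card (W q i) \<le> card {A \<in> halves (S i). sum z A = - sum z (K i)}"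
          using fin\<Omega> by (intro card_mono) auto
        ultimately show ?thesis using True by simp
      next
        case False
        have "card (W q i) \<le> card (halves (S i))"
          unfolding W_def using fin\<Omega> by (intro card_mono) auto
        then show ?thesis unfolding if_not_P[OF False] by simp
      qed
      have "(\<Prod>i\<in>{..<h} - P. real (card (W q i)))
          \<le> (\<Prod>i\<in>{..<h} - P. (if i \<in> G - P then 3 / 4 else 1) * real (card (halves (S i))))"
        by (intro prod_mono conjI W_le) simp
      also have "\<dots> = (\<Prod>i\<in>{..<h} - P. if i \<in> G - P then 3 / 4 else 1) * (\<Prod>i\<in>{..<h} - P. real (card (halves (S i))))"
        by (rule prod.distrib)
      also have "(\<Prod>i\<in>{..<h} - P. if i \<in> G - P then 3 / 4 else (1::real)) = (\<Prod>i\<in>({..<h} - P) \<inter> (G - P). 3 / 4)"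
        by (rule prod.inter_restrict[symmetric]) simp
      also have "({..<h} - P) \<inter> (G - P) = G - P" using G(1) by blast
      also have "(\<Prod>i\<in>G - P. 3 / 4 :: real) * (\<Prod>i\<in>{..<h} - P. real (card (halves (S i))))
          \<le> (3 / 4) ^ (g - (k + 1)) * (\<Prod>i\<in>{..<h} - P. real (card (halves (S i))))"
        using cardG by (intro mult_right_mono prod_nonneg) (auto intro: power_decreasing)
      finally show "(\<Prod>i\<in>{..<h} - P. real (card (W q i)))
          \<le> (3 / 4) ^ (g - (k + 1)) * (\<Prod>i\<in>{..<h} - P. real (card (halves (S i))))" .
    qed (use P fin\<Omega> in \<open>auto simp: F_def \<Phi>_def W_def dest: PiE_mem\<close>)
  qed
  have "real (card ?B) \<le> real (card \<A>) * ((3 / 4) ^ (g - (k + 1)) * real (card \<Phi>))"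
  proof (rule card_le_of_cover[OF fin\<A> cover])
    show "finite (case a of (J, P) \<Rightarrow> F J P)" for a
      unfolding F_def using fin\<Phi> by (auto split: prod.split)
    show "real (card (case a of (J, P) \<Rightarrow> F J P)) \<le> (3 / 4) ^ (g - (k + 1)) * real (card \<Phi>)"
      if "a \<in> \<A>" for a
      using that F_le by (cases a) auto
  qed
  also have "\<dots> \<le> (real (card {J. J \<subseteq> {..<n} \<and> card J \<le> k}) * real (card {P. P \<subseteq> {..<h} \<and> card P \<le> k + 1}))
      * ((3 / 4) ^ (g - (k + 1)) * real (card \<Phi>))"
  proof (intro mult_right_mono)
    have "card \<A> \<le> card ({J. J \<subseteq> {..<n} \<and> card J \<le> k} \<times> {P. P \<subseteq> {..<h} \<and> card P \<le> k + 1})"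
      unfolding \<A>_def by (intro card_mono) auto
    then show "real (card \<A>) \<le> real (card {J. J \<subseteq> {..<n} \<and> card J \<le> k}) * real (card {P. P \<subseteq> {..<h} \<and> card P \<le> k + 1})"
      by (simp only: card_cartesian_product of_nat_mult[symmetric] of_nat_le_iff)
  qed auto
  finally show ?thesis .
qed

lemma card_le_of_fibres:
  fixes \<epsilon> :: real
  assumes R: "finite R" "B \<subseteq> R"
    and le: "\<And>E. E \<in> B \<Longrightarrow> real (card {F \<in> B. key F = key E}) \<le> \<epsilon> * real (card {F \<in> R. key F = key E})"
    and \<epsilon>: "0 \<le> \<epsilon>"
  shows "real (card B) \<le> \<epsilon> * real (card R)"
proof -
  have B: "finite B" using R by (rule finite_subset[rotated])
  have "real (card B) = (\<Sum>\<kappa>\<in>key ` R. real (card {F \<in> B. key F = \<kappa>}))"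
    using sum.group[OF B, of "key ` R" key "\<lambda>_. 1 :: real"] R by (simp add: image_mono)
  also have "\<dots> \<le> (\<Sum>\<kappa>\<in>key ` R. \<epsilon> * real (card {F \<in> R. key F = \<kappa>}))"
  proof (rule sum_mono)
    fix \<kappa>
    show "real (card {F \<in> B. key F = \<kappa>}) \<le> \<epsilon> * real (card {F \<in> R. key F = \<kappa>})"
    proof (cases "\<exists>E\<in>B. key E = \<kappa>")
      case False
      then have *: "{F \<in> B. key F = \<kappa>} = {}" by blast
      show ?thesis unfolding * using \<epsilon> by simp
    qed (use le in blast)
  qed
  also have "\<dots> = \<epsilon> * real (card R)"
    using sum.group[OF R(1), of "key ` R" key "\<lambda>_. 1 :: real"] R(1)
    by (simp add: sum_distrib_left[symmetric])
  finally show ?thesis .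
qed

section \<open>Regular graphs with fixed pair data as products of halves\<close>

definition row_common :: "nat \<Rightarrow> (nat \<times> nat) set \<Rightarrow> nat \<Rightarrow> nat set" where
  "row_common h E i = E `` {i} \<inter> E `` {h + i}"

text \<open>All that resampling leaves fixed. The restriction to \<open>{..<h}\<close> matters: for
  larger indices \<open>row_diff\<close> compares rows of different pairs, which resampling may
  change.\<close>

definition pair_key :: "nat \<Rightarrow> (nat \<times> nat) set \<Rightarrow> (nat \<Rightarrow> nat set \<times> nat set) \<times> (nat \<times> nat) set" where
  "pair_key h E = ((\<lambda>i\<in>{..<h}. (row_diff h E i, row_common h E i)), E \<inter> {2 * h..} \<times> UNIV)"

definition first_half :: "nat \<Rightarrow> (nat \<times> nat) set \<Rightarrow> nat \<Rightarrow> nat set" where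
  "first_half h E = (\<lambda>i\<in>{..<h}. E `` {i} - E `` {h + i})"

lemma pair_key_eqD:
  assumes "pair_key h E = pair_key h F"
  shows "i < h \<Longrightarrow> row_diff h E i = row_diff h F i" "i < h \<Longrightarrow> row_common h E i = row_common h F i"
    "2 * h \<le> i \<Longrightarrow> E `` {i} = F `` {i}"
proof -
  have 1: "(\<lambda>i\<in>{..<h}. (row_diff h E i, row_common h E i)) = (\<lambda>i\<in>{..<h}. (row_diff h F i, row_common h F i))"
    and 2: "E \<inter> {2 * h..} \<times> UNIV = F \<inter> {2 * h..} \<times> UNIV"
    using assms unfolding pair_key_def by auto
  from fun_cong[OF 1, of i] show "i < h \<Longrightarrow> row_diff h E i = row_diff h F i" "i < h \<Longrightarrow> row_common h E i = row_common h F i"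
    by auto
  show "E `` {i} = F `` {i}" if "2 * h \<le> i"
  proof -
    have "E `` {i} = (E \<inter> {2 * h..} \<times> UNIV) `` {i}" "F `` {i} = (F \<inter> {2 * h..} \<times> UNIV) `` {i}"
      using that by auto
    then show ?thesis using 2 by simp
  qed
qed

lemma Image_eq_resampled_row:
  assumes "pair_key h E = pair_key h F"
  shows "E `` {i} = resampled_row h (row_diff h F) (row_common h F) (\<lambda>i. F `` {i}) (first_half h E) i"
proof -
  consider "i < h" | "h \<le> i" "i - h < h" "i < 2 * h" | "2 * h \<le> i" by linarith
  then show ?thesis
  proof cases
    case 1
    then show ?thesis
      unfolding resampled_row_def first_half_def pair_key_eqD(2)[OF assms 1, symmetric] unfolding row_common_def using 1 by auto
  next
    case 2
    then have "h + (i - h) = i" by simp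
    then show ?thesis
      using 2 unfolding resampled_row_def first_half_def pair_key_eqD(1,2)[OF assms 2(2), symmetric]
      unfolding row_common_def row_diff_def by auto
  next
    case 3
    then show ?thesis using pair_key_eqD(3)[OF assms 3] unfolding resampled_row_def by simp
  qed
qed

lemma card_row_diff_eq:
  assumes E: "E \<in> reg n d" and i: "i < h" "2 * h \<le> n"
  shows "card (E `` {i} - E `` {h + i}) + card (row_common h E i) = d"
    "card (row_diff h E i) = 2 * card (E `` {i} - E `` {h + i})"
proof -
  let ?A = "E `` {i}" and ?B = "E `` {h + i}"
  have fin: "finite ?A" "finite ?B" using finite_Image_reg(1)[OF E] by auto
  have A: "card (?A - ?B) + card (?A \<inter> ?B) = card ?A"
    using fin by (subst card_Un_disjoint[symmetric]) (auto intro!: arg_cong[where f = card])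
  have B: "card (?B - ?A) + card (?A \<inter> ?B) = card ?B"
    using fin by (subst card_Un_disjoint[symmetric]) (auto intro!: arg_cong[where f = card])
  have "card (row_diff h E i) = card (?A - ?B) + card (?B - ?A)"
    unfolding row_diff_def using fin by (intro card_Un_disjoint) auto
  moreover have "card ?A = d" "card ?B = d" using reg_row[OF E] i by auto
  ultimately show "card (?A - ?B) + card (row_common h E i) = d" "card (row_diff h E i) = 2 * card (?A - ?B)"
    using A B unfolding row_common_def by auto
qed

lemma first_half_in_halves:
  assumes E: "E \<in> reg n d" and F: "F \<in> reg n d" "pair_key h E = pair_key h F" and h: "2 * h \<le> n"
  shows "first_half h E \<in> PiE {..<h} (\<lambda>i. halves (row_diff h F i))"
  unfolding first_half_def halves_def
  using card_row_diff_eq(2)[OF E _ h] pair_key_eqD(1)[OF F(2)] by (auto simp: row_diff_def)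

text \<open>Meant for columns: resampling moves an entry of a column only between the two rows of
  one pair, so every summand here is preserved.\<close>

lemma card_split_pairs:
  fixes A :: "nat set" and h :: nat
  assumes "finite A"
  shows "card A = (\<Sum>i<h. of_bool (i \<in> A) + of_bool (h + i \<in> A)) + card (A \<inter> {2 * h..})"
proof -
  have "(+) h ` {i. i < h \<and> h + i \<in> A} = A \<inter> {h..<2 * h}"
  proof safe
    fix i assume "i \<in> A" "i \<in> {h..<2 * h}"
    then show "i \<in> (+) h ` {i. i < h \<and> h + i \<in> A}"
      by (intro image_eqI[of _ _ "i - h"]) auto
  qed auto
  then have mid: "card (A \<inter> {h..<2 * h}) = card {i. i < h \<and> h + i \<in> A}"
    using card_image[of "(+) h" "{i. i < h \<and> h + i \<in> A}"] by simp
  have "A = (A \<inter> {..<h}) \<union> (A \<inter> {h..<2 * h}) \<union> (A \<inter> {2 * h..})" by auto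
  then have "card A = card ((A \<inter> {..<h}) \<union> (A \<inter> {h..<2 * h}) \<union> (A \<inter> {2 * h..}))" by simp
  also have "\<dots> = card (A \<inter> {..<h}) + card (A \<inter> {h..<2 * h}) + card (A \<inter> {2 * h..})"
    using assms by (subst card_Un_disjoint, auto)+
  finally have "card A = card (A \<inter> {..<h}) + card {i. i < h \<and> h + i \<in> A} + card (A \<inter> {2 * h..})"
    unfolding mid .
  moreover have "(\<Sum>i<h. of_bool (i \<in> A)) = card (A \<inter> {..<h})"
    by (simp add: Int_commute of_bool_def sum.If_cases Collect_mem_eq)
  moreover have "(\<Sum>i<h. of_bool (h + i \<in> A)) = card {i. i < h \<and> h + i \<in> A}"
    by (simp add: of_bool_def sum.If_cases Collect_conj_eq lessThan_def)
  ultimately show ?thesis by (simp add: sum.distrib)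
qed

definition rebuild :: "nat \<Rightarrow> nat \<Rightarrow> (nat \<times> nat) set \<Rightarrow> (nat \<Rightarrow> nat set) \<Rightarrow> (nat \<times> nat) set" where
  "rebuild n h E f = {(i, j). i < n \<and> j \<in> resampled_row h (row_diff h E) (row_common h E) (\<lambda>i. E `` {i}) f i}"

text \<open>Every choice of halves is realised by a graph in the same fibre. Since
  \<open>first_half\<close> also determines a graph within its fibre, the uniform graph conditioned
  on \<open>pair_key\<close> amounts to independent uniform halves.\<close>

lemma rebuild_props:
  assumes E: "E \<in> reg n d" and h: "2 * h \<le> n" and f: "f \<in> PiE {..<h} (\<lambda>i. halves (row_diff h E i))"
  shows "rebuild n h E f \<in> reg n d" "pair_key h (rebuild n h E f) = pair_key h E"
    "first_half h (rebuild n h E f) = f"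
proof -
  let ?F = "rebuild n h E f"
  have fi: "f i \<subseteq> row_diff h E i" "2 * card (f i) = card (row_diff h E i)" if "i < h" for i
    using f that unfolding halves_def by (auto simp: PiE_iff)
  have row: "?F `` {i} = resampled_row h (row_diff h E) (row_common h E) (\<lambda>i. E `` {i}) f i" if "i < n" for i
    using that unfolding rebuild_def by auto
  have row1: "?F `` {i} = row_common h E i \<union> f i" if "i < h" for i
    using that h by (subst row) (auto simp: resampled_row_def)
  have row2: "?F `` {h + i} = row_common h E i \<union> (row_diff h E i - f i)" if "i < h" for i
    using that h by (subst row) (auto simp: resampled_row_def)
  have row3: "?F `` {i} = E `` {i}" if "2 * h \<le> i" for i
  proof (cases "i < n")
    case False
    then have "E `` {i} = {}" using reg_subset[OF E] by auto
    moreover have "?F `` {i} = {}" using False unfolding rebuild_def by auto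
    ultimately show ?thesis by simp
  qed (use that in \<open>simp add: row resampled_row_def\<close>)
  have disj: "row_diff h E i \<inter> row_common h E i = {}" for i unfolding row_diff_def row_common_def by auto
  have sdF: "row_diff h ?F i = row_diff h E i" and cmF: "row_common h ?F i = row_common h E i"
    and fF: "?F `` {i} - ?F `` {h + i} = f i" if i: "i < h" for i
    using fi(1)[OF i] disj[of i] unfolding row_diff_def[of h ?F] row_common_def[of h ?F] row1[OF i] row2[OF i] by auto
  show key: "pair_key h ?F = pair_key h E"
  proof -
    have "(\<lambda>i\<in>{..<h}. (row_diff h ?F i, row_common h ?F i)) = (\<lambda>i\<in>{..<h}. (row_diff h E i, row_common h E i))"
      using sdF cmF by (intro restrict_ext) auto
    moreover have "?F \<inter> {2 * h..} \<times> UNIV = E \<inter> {2 * h..} \<times> UNIV"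
      using row3 by blast
    ultimately show ?thesis unfolding pair_key_def by simp
  qed
  show "first_half h ?F = f"
  proof
    fix i show "first_half h ?F i = f i"
    proof (cases "i < h")
      case True
      then show ?thesis using fF unfolding first_half_def by simp
    next
      case False
      then show ?thesis using f unfolding first_half_def by (auto simp: PiE_iff extensional_def)
    qed
  qed
  have sub: "?F \<subseteq> {..<n} \<times> {..<n}"
  proof -
    have "?F `` {i} \<subseteq> {..<n}" for i
    proof -
      consider "i < h" | "h \<le> i" "i - h < h" | "2 * h \<le> i" by linarith
      then show ?thesis
      proof cases
        case 1
        then show ?thesis using row1 fi(1)[OF 1] reg_Image_subset(1)[OF E] unfolding row_diff_def row_common_def by blast
      next
        case 2
        then show ?thesis using row2[OF 2(2)] reg_Image_subset(1)[OF E] unfolding row_diff_def row_common_def by auto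
      next
        case 3
        then show ?thesis using row3 reg_Image_subset(1)[OF E] by simp
      qed
    qed
    then have "j < n" if "(i, j) \<in> ?F" for i j using that by blast
    moreover have "i < n" if "(i, j) \<in> ?F" for i j using that unfolding rebuild_def by auto
    ultimately show ?thesis by auto
  qed
  have fin: "finite (E `` A)" "finite (E\<inverse> `` A)" "finite (?F `` A)" "finite (?F\<inverse> `` A)" for A
    using finite_Image_reg[OF E] finite_subset[OF sub] by (auto intro: finite_Image)
  have finS: "finite (row_diff h E i)" "finite (row_common h E i)" for i
    unfolding row_diff_def row_common_def using fin by auto
  show "?F \<in> reg n d"
    unfolding reg_def
  proof (intro CollectI conjI allI impI sub)
    fix i assume "i < n"
    consider "i < h" | "h \<le> i" "i - h < h" | "2 * h \<le> i" by linarith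
    then show "card (?F `` {i}) = d"
    proof cases
      case 1
      have "card (?F `` {i}) = card (row_common h E i) + card (f i)"
        unfolding row1[OF 1] using fi(1)[OF 1] disj[of i] finS finite_subset[OF fi(1)[OF 1]]
        by (intro card_Un_disjoint) auto
      then show ?thesis using card_row_diff_eq[OF E 1 h] fi(2)[OF 1] by simp
    next
      case 2
      define k where "k = i - h"
      have k: "k < h" "i = h + k" using 2 unfolding k_def by auto
      have "card (?F `` {i}) = card (row_common h E k) + card (row_diff h E k - f k)"
        unfolding k(2) row2[OF k(1)] using disj[of k] finS by (intro card_Un_disjoint) auto
      moreover have "card (row_diff h E k - f k) = card (row_diff h E k) - card (f k)"
        using fi(1)[OF k(1)] finite_subset[OF fi(1)[OF k(1)] finS(1)] by (intro card_Diff_subset) auto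
      ultimately show ?thesis using card_row_diff_eq[OF E k(1) h] fi(2)[OF k(1)] by simp
    next
      case 3
      then show ?thesis using row3 reg_row[OF E \<open>i < n\<close>] by simp
    qed
  next
    fix j assume j: "j < n"
    \<comment> \<open>A column in the difference goes to exactly one row of the pair, a common
      column to both, before and after resampling.\<close>
    have "of_bool (i \<in> ?F\<inverse> `` {j}) + of_bool (h + i \<in> ?F\<inverse> `` {j})
        = (of_bool (i \<in> E\<inverse> `` {j}) + of_bool (h + i \<in> E\<inverse> `` {j}) :: nat)" if i: "i < h" for i
    proof -
      have "i \<in> ?F\<inverse> `` {j} \<longleftrightarrow> j \<in> row_common h E i \<union> f i" "h + i \<in> ?F\<inverse> `` {j} \<longleftrightarrow> j \<in> row_common h E i \<union> (row_diff h E i - f i)"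
        using row1[OF i] row2[OF i] by auto
      then show ?thesis using fi(1)[OF i] unfolding row_common_def row_diff_def by (auto simp: of_bool_def)
    qed
    moreover have "?F\<inverse> `` {j} \<inter> {2 * h..} = E\<inverse> `` {j} \<inter> {2 * h..}" using row3 by blast
    ultimately have "card (?F\<inverse> `` {j}) = card (E\<inverse> `` {j})"
      unfolding card_split_pairs[OF fin(4), of _ h] card_split_pairs[OF fin(2), of _ h] by simp
    then show "card (?F\<inverse> `` {j}) = d" using reg_col[OF E j] by simp
  qed
qed

section \<open>Probability of kernel vectors with a large exceptional set\<close>

definition spread_kernel :: "nat \<Rightarrow> nat \<Rightarrow> nat \<Rightarrow> (nat \<Rightarrow> nat set) \<Rightarrow> bool" where
  "spread_kernel n m k R \<longleftrightarrow> (\<exists>(x :: nat \<Rightarrow> real) a. m \<le> card {j. j < n \<and> x j \<noteq> a} \<and>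
      card {j. j < n \<and> x j \<noteq> a} \<le> k \<and> (\<forall>i<n. sum x (R i) = 0))"

definition many_split_pairs :: "nat \<Rightarrow> nat \<Rightarrow> nat \<Rightarrow> nat \<Rightarrow> nat \<Rightarrow> (nat \<Rightarrow> nat set) \<Rightarrow> bool" where
  "many_split_pairs n h m k g S \<longleftrightarrow> (\<forall>J \<subseteq> {..<n}. m \<le> card J \<longrightarrow> card J \<le> k \<longrightarrow>
      g \<le> card {i. i < h \<and> S i \<inter> J \<noteq> {} \<and> \<not> S i \<subseteq> J})"

text \<open>\<open>many_split_pairs\<close> looks only at the differences recorded in
  \<open>pair_key\<close>, so it is a property of the whole fibre. The product bound can thus be
  applied fibre by fibre.\<close>

lemma card_spread_kernel_le:
  assumes h: "2 * h \<le> n"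
  shows "real (card {E \<in> reg n d. many_split_pairs n h m k g (row_diff h E) \<and> spread_kernel n m k (\<lambda>i. E `` {i})})
    \<le> real (card {J. J \<subseteq> {..<n} \<and> card J \<le> k}) * real (card {P. P \<subseteq> {..<h} \<and> card P \<le> k + 1})
      * (3 / 4) ^ (g - (k + 1)) * real (card (reg n d))"
    (is "real (card ?B) \<le> ?c * _")
proof (rule card_le_of_fibres[where key = "pair_key h"])
  fix E assume "E \<in> ?B"
  then have E: "E \<in> reg n d" and good: "many_split_pairs n h m k g (row_diff h E)" by auto
  let ?\<Phi> = "PiE {..<h} (\<lambda>i. halves (row_diff h E i))"
  let ?C = "{F \<in> reg n d. pair_key h F = pair_key h E}"
  let ?resampled_row = "resampled_row h (row_diff h E) (row_common h E) (\<lambda>i. E `` {i})"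
  have sub: "row_diff h E i \<subseteq> {..<n}" "row_common h E i \<subseteq> {..<n}" for i
    using reg_Image_subset(1)[OF E] unfolding row_diff_def row_common_def by blast+
  have fin: "finite ?\<Phi>"
    by (intro finite_PiE finite_halves finite_subset[OF sub(1)]) auto
  have inj: "inj_on (first_half h) ?C"
  proof (rule inj_onI)
    fix F F' assume F: "F \<in> ?C" "F' \<in> ?C" and eq: "first_half h F = first_half h F'"
    have "F `` {i} = F' `` {i}" for i
      using Image_eq_resampled_row[of h F E i] Image_eq_resampled_row[of h F' E i] F eq by simp
    then have "(i, j) \<in> F \<longleftrightarrow> (i, j) \<in> F'" for i j by (metis Image_singleton_iff)
    then show "F = F'" by auto
  qed
  have "first_half h ` {F \<in> ?B. pair_key h F = pair_key h E} \<subseteq> {f \<in> ?\<Phi>. spread_kernel n m k (?resampled_row f)}"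
  proof
    fix f assume "f \<in> first_half h ` {F \<in> ?B. pair_key h F = pair_key h E}"
    then obtain F where F: "F \<in> reg n d" "spread_kernel n m k (\<lambda>i. F `` {i})" "pair_key h F = pair_key h E"
      and f: "f = first_half h F" by blast
    have "(\<lambda>i. F `` {i}) = ?resampled_row f" unfolding f using Image_eq_resampled_row[OF F(3)] by blast
    then show "f \<in> {f \<in> ?\<Phi>. spread_kernel n m k (?resampled_row f)}"
      using first_half_in_halves[OF F(1) E F(3) h] F(2) f by simp
  qed
  then have "card {F \<in> ?B. pair_key h F = pair_key h E} \<le> card {f \<in> ?\<Phi>. spread_kernel n m k (?resampled_row f)}"
    by (rule card_inj_on_le[rotated]) (use fin inj in \<open>auto intro: inj_on_subset\<close>)
  then have "real (card {F \<in> ?B. pair_key h F = pair_key h E}) \<le> real (card {f \<in> ?\<Phi>. spread_kernel n m k (?resampled_row f)})"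
    by (rule of_nat_mono)
  also have "\<dots> \<le> real (card {J. J \<subseteq> {..<n} \<and> card J \<le> k}) * real (card {P. P \<subseteq> {..<h} \<and> card P \<le> k + 1})
      * ((3 / 4) ^ (g - (k + 1)) * real (card ?\<Phi>))"
    unfolding spread_kernel_def
  proof (rule card_kernel_halves_le[OF h sub reg_Image_subset(1)[OF E]])
    show "row_diff h E i \<inter> row_common h E i = {}" for i unfolding row_diff_def row_common_def by auto
  qed (use good in \<open>auto simp: many_split_pairs_def\<close>)
  also have "\<dots> \<le> ?c * real (card ?C)"
  proof -
    have "?\<Phi> \<subseteq> first_half h ` ?C"
    proof
      fix f assume "f \<in> ?\<Phi>"
      from rebuild_props[OF E h this] show "f \<in> first_half h ` ?C"
        by (intro image_eqI[of _ _ "rebuild n h E f"]) auto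
    qed
    then have "card ?\<Phi> \<le> card ?C" using finite_reg by (intro surj_card_le) auto
    then have "?c * real (card ?\<Phi>) \<le> ?c * real (card ?C)" by (intro mult_left_mono) auto
    then show ?thesis by (simp only: mult.assoc)
  qed
  finally show "real (card {F \<in> ?B. pair_key h F = pair_key h E}) \<le> ?c * real (card ?C)" .
qed (use finite_reg in auto)

section \<open>Null vectors of expanding graphs\<close>

definition null_vector :: "nat \<Rightarrow> nat \<Rightarrow> (nat \<times> nat) set \<Rightarrow> bool" where
  "null_vector n k E \<longleftrightarrow> (\<exists>(x :: nat \<Rightarrow> real) a. (\<exists>j<n. x j \<noteq> 0) \<and> card {j. j < n \<and> x j \<noteq> a} \<le> k \<and>
      (\<forall>i<n. sum x (E `` {i}) = 0))"

text \<open>Each difference set inside \<open>J\<close> contributes at least d edges ending in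
  \<open>J\<close>, distinct for distinct pairs, while only d|J| such edges exist.\<close>

lemma card_row_diff_subset_le:
  assumes E: "E \<in> reg n d" and d: "0 < d" and J: "J \<subseteq> {..<n}"
    and large: "\<And>i. i < h \<Longrightarrow> d \<le> card (row_diff h E i)"
  shows "card {i. i < h \<and> row_diff h E i \<subseteq> J} \<le> card J"
proof -
  let ?B = "{i. i < h \<and> row_diff h E i \<subseteq> J}"
  have fin: "finite (row_diff h E i)" for i
    unfolding row_diff_def using finite_Image_reg(1)[OF E] by simp
  let ?f = "\<lambda>(i, j). (if (i, j) \<in> E then i else h + i, j)"
  have "card ?B * d \<le> (\<Sum>i\<in>?B. card (row_diff h E i))"
    using large sum_mono[of ?B "\<lambda>_. d" "\<lambda>i. card (row_diff h E i)"] by simp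
  also have "\<dots> = card (SIGMA i:?B. row_diff h E i)"
    using fin by (intro card_SigmaI[symmetric]) auto
  also have "\<dots> \<le> card (E \<inter> UNIV \<times> J)"
  proof (rule card_inj_on_le[where f = ?f])
    show "inj_on ?f (SIGMA i:?B. row_diff h E i)"
      by (rule inj_onI) (auto split: if_splits)
    show "?f ` (SIGMA i:?B. row_diff h E i) \<subseteq> E \<inter> UNIV \<times> J"
      unfolding row_diff_def by (auto split: if_splits)
    show "finite (E \<inter> UNIV \<times> J)" using reg_finite[OF E] by simp
  qed
  also have "\<dots> = card J * d" by (rule card_Int_cols[OF E J])
  finally show ?thesis using d by simp
qed

lemma card_Image_le:
  assumes E: "E \<in> reg n d" and J: "J \<subseteq> {..<n}"
  shows "card (E\<inverse> `` J) \<le> card J * d"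
proof -
  have "E\<inverse> `` J = fst ` (E \<inter> UNIV \<times> J)" by force
  then have "card (E\<inverse> `` J) \<le> card (E \<inter> UNIV \<times> J)"
    using reg_finite[OF E] by (simp add: card_image_le)
  then show ?thesis using card_Int_cols[OF E J] by simp
qed

text \<open>The deterministic part. The condition on \<open>g\<close> budgets the last case: at
  least md/8 differences meet \<open>J\<close>, at most k of them are contained in it, and g must
  remain.\<close>

lemma no_null_vector:
  defines "h \<equiv> \<lambda>n :: nat. n div 2"
  assumes E: "E \<in> reg n d" and d: "0 < d" and md: "m * d < n" "4 \<le> m * d" and g: "8 * (g + k) \<le> m * d"
    and exp: "\<And>J. J \<subseteq> {..<n} \<Longrightarrow> 0 < card J \<Longrightarrow> card J \<le> m \<Longrightarrow> 3 * (card J * d) < 4 * card (E\<inverse> `` J)"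
    and dbl: "\<And>J. J \<subseteq> {..<n} \<Longrightarrow> card J = m \<Longrightarrow> 8 * card (double_hits (h n) E J) < m * d"
    and two: "\<And>I. I \<subseteq> {..<n} \<Longrightarrow> card I = 2 \<Longrightarrow> 3 * (2 * d) < 4 * card (E `` I)"
    and spread: "\<not> (many_split_pairs n (h n) m k g (row_diff (h n) E) \<and> spread_kernel n m k (\<lambda>i. E `` {i}))"
  shows "\<not> null_vector n k E"
proof
  assume "null_vector n k E"
  then obtain x :: "nat \<Rightarrow> real" and a where nz: "\<exists>j<n. x j \<noteq> 0"
    and Jk: "card {j. j < n \<and> x j \<noteq> a} \<le> k" and ker: "\<And>i. i < n \<Longrightarrow> sum x (E `` {i}) = 0"
    unfolding null_vector_def by blast
  define J where "J = {j. j < n \<and> x j \<noteq> a}"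
  have J: "J \<subseteq> {..<n}" "finite J" unfolding J_def by auto
  have n: "0 < n" using md by simp
  \<comment> \<open>A row that avoids \<open>J\<close> sees the value \<open>a\<close> exactly d
    times.\<close>
  have const: "a = 0" if i: "i < n" "i \<notin> E\<inverse> `` J" for i
  proof -
    have "x j = a" if "j \<in> E `` {i}" for j
      using that i reg_Image_subset(1)[OF E, of "{i}"] unfolding J_def by auto
    then have "sum x (E `` {i}) = (\<Sum>j\<in>E `` {i}. a)" by (rule sum.cong[OF refl])
    then have "real d * a = 0" using reg_row[OF E i(1)] ker[OF i(1)] by simp
    then show ?thesis using d by simp
  qed
  consider "J = {}" | "0 < card J" "card J \<le> m" | "m < card J" using J(2) by fastforce
  then show False
  proof cases
    case 1
    then have "a = 0" using const[OF n] by simp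
    then show False using nz 1 unfolding J_def by auto
  next
    case 2
    have exp': "3 * (card J * d) < 4 * card (E\<inverse> `` J)" by (rule exp[OF J(1) 2])
    have "card (E\<inverse> `` J) \<le> card J * d" by (rule card_Image_le[OF E J(1)])
    also have "\<dots> \<le> m * d" using 2(2) by simp
    also have "\<dots> < n" by (rule md)
    finally have "\<not> {..<n} \<subseteq> E\<inverse> `` J"
      using card_mono[OF finite_Image_reg(2)[OF E], of "{..<n}" J] by auto
    then obtain i where "i < n" "i \<notin> E\<inverse> `` J" by auto
    from const[OF this] have a: "a = 0" .
    obtain i j where i: "i < n" "j \<in> J" "E `` {i} \<inter> J = {j}"
      using unique_neighbour_exists[OF E J(1) exp'] by blast
    have "sum x (E `` {i}) = sum x (E `` {i} \<inter> J)"
      using finite_Image_reg(1)[OF E] reg_Image_subset(1)[OF E, of "{i}"] a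
      by (intro sum.mono_neutral_right) (auto simp: J_def)
    also have "\<dots> = x j" using i by simp
    finally show False using ker[OF i(1)] i(2) a unfolding J_def by simp
  next
    case 3
    have "spread_kernel n m k (\<lambda>i. E `` {i})"
      unfolding spread_kernel_def using 3 Jk ker unfolding J_def by (intro exI[of _ x] exI[of _ a]) auto
    moreover have "many_split_pairs n (h n) m k g (row_diff (h n) E)"
      unfolding many_split_pairs_def
    proof (intro allI impI)
      fix J assume J: "J \<subseteq> {..<n}" "m \<le> card J" "card J \<le> k"
      \<comment> \<open>Expansion is available only up to size m. A subset \<open>J0\<close> of that
        size suffices to find differences meeting \<open>J\<close>; those contained in
        \<open>J\<close> are counted separately against the full set.\<close>
      obtain J0 where J0: "J0 \<subseteq> J" "card J0 = m" "finite J0"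
        using obtain_subset_with_card_n[OF J(2)] by blast
      have J0n: "J0 \<subseteq> {..<n}" using J0(1) J(1) by blast
      have "0 < m" using md by (cases m) auto
      let ?U = "{i. i < h n \<and> row_diff (h n) E i \<inter> J0 \<noteq> {}}"
      let ?V = "{i. i < h n \<and> row_diff (h n) E i \<subseteq> J}"
      have "m * d \<le> 8 * card ?U"
        using card_pairs_hit_ge[OF E J0n] exp[OF J0n] dbl[OF J0n] J0(2) md \<open>0 < m\<close>
        unfolding h_def by simp
      with g have "8 * (g + k) \<le> 8 * card ?U" by (rule order.trans)
      then have "g + k \<le> card ?U" by simp
      moreover have "card ?V \<le> card J"
      proof (rule card_row_diff_subset_le[OF E d J(1)])
        fix i assume i: "i < h n"
        then have "h n + i < n" "i \<noteq> h n + i" unfolding h_def by auto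
        then show "d \<le> card (row_diff (h n) E i)"
          using two[of "{i, h n + i}"] by (intro card_row_diff_ge[OF E]) auto
      qed
      moreover have "card ?U - card ?V \<le> card (?U - ?V)"
        by (rule diff_card_le_card_Diff) simp
      moreover have "card (?U - ?V) \<le> card {i. i < h n \<and> row_diff (h n) E i \<inter> J \<noteq> {} \<and> \<not> row_diff (h n) E i \<subseteq> J}"
        using J0(1) by (intro card_mono) auto
      ultimately show "g \<le> card {i. i < h n \<and> row_diff (h n) E i \<inter> J \<noteq> {} \<and> \<not> row_diff (h n) E i \<subseteq> J}"
        using J(3) by linarith
    qed
    ultimately show False using spread by blast
  qed
qed

lemma card_converse_reg:
  "card {E \<in> reg n d. P (E\<inverse>)} = card {E \<in> reg n d. P E}"
  by (rule bij_betw_same_card[of converse], rule bij_betwI[where g = converse]) auto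

lemma card_null_vector_le:
  fixes n d m k g :: nat
  assumes d: "0 < d" and md: "m * d < n" "4 \<le> m * d" and g: "8 * (g + k) \<le> m * d"
  shows "card {E \<in> reg n d. null_vector n k E}
    \<le> (\<Sum>q\<in>{1..m}. card {E \<in> reg n d. \<exists>J \<subseteq> {..<n}. card J = q \<and> 4 * card (E\<inverse> `` J) \<le> 3 * (q * d)})
      + card {E \<in> reg n d. \<exists>J \<subseteq> {..<n}. card J = 2 \<and> 4 * card (E\<inverse> `` J) \<le> 3 * (2 * d)}
      + card {E \<in> reg n d. \<exists>J \<subseteq> {..<n}. card J = m \<and> m * d \<le> 8 * card (double_hits (n div 2) E J)}
      + card {E \<in> reg n d. many_split_pairs n (n div 2) m k g (row_diff (n div 2) E) \<and> spread_kernel n m k (\<lambda>i. E `` {i})}"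
    (is "card ?N \<le> (\<Sum>q\<in>_. card (?X q)) + card ?Y + card ?D + card ?S")
proof -
  let ?Z = "{E \<in> reg n d. \<exists>J \<subseteq> {..<n}. card J = 2 \<and> 4 * card (E `` J) \<le> 3 * (2 * d)}"
  have fin: "finite {E \<in> reg n d. P E}" for P using finite_reg by simp
  have "?N \<subseteq> (\<Union>q\<in>{1..m}. ?X q) \<union> ?Z \<union> ?D \<union> ?S"
  proof (rule subsetI, rule ccontr)
    fix E assume E: "E \<in> ?N" and contr: "E \<notin> (\<Union>q\<in>{1..m}. ?X q) \<union> ?Z \<union> ?D \<union> ?S"
    then have Er: "E \<in> reg n d" by simp
    have "\<not> null_vector n k E"
    proof (rule no_null_vector[OF Er d md g])
      show "3 * (card J * d) < 4 * card (E\<inverse> `` J)" if "J \<subseteq> {..<n}" "0 < card J" "card J \<le> m" for J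
      proof (rule ccontr)
        assume "\<not> ?thesis"
        then have "E \<in> ?X (card J)" using Er that by auto
        moreover have "card J \<in> {1..m}" using that by simp
        ultimately show False using contr by blast
      qed
      show "8 * card (double_hits (n div 2) E J) < m * d" if "J \<subseteq> {..<n}" "card J = m" for J
        using contr that Er by (simp add: not_le)
      show "3 * (2 * d) < 4 * card (E `` I)" if "I \<subseteq> {..<n}" "card I = 2" for I
        using contr that Er by (simp add: not_le)
      show "\<not> (many_split_pairs n (n div 2) m k g (row_diff (n div 2) E) \<and> spread_kernel n m k (\<lambda>i. E `` {i}))"
        using contr Er by blast
    qed
    then show False using E by simp
  qed
  then have "card ?N \<le> card ((\<Union>q\<in>{1..m}. ?X q) \<union> ?Z \<union> ?D \<union> ?S)"
    using fin by (intro card_mono) auto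
  also have "\<dots> \<le> card (\<Union>q\<in>{1..m}. ?X q) + card ?Z + card ?D + card ?S"
    by (intro order.trans[OF card_Un_le] add_mono order.refl)
  also have "card (\<Union>q\<in>{1..m}. ?X q) \<le> (\<Sum>q\<in>{1..m}. card (?X q))"
    by (rule card_UN_le) simp
  \<comment> \<open>Expansion of two rows is expansion of two columns in the transposed
    graph.\<close>
  also have "card ?Z = card ?Y"
    using card_converse_reg[of n d "\<lambda>E. \<exists>J \<subseteq> {..<n}. card J = 2 \<and> 4 * card (E `` J) \<le> 3 * (2 * d)"] by simp
  finally show ?thesis by simp
qed

section \<open>Probability estimates\<close>

text \<open>The exponent qd/4 is cut in half. For large d one half absorbs the binomial coefficient,
  at most (3 * 14^4 d/u)^q with u = 14^4 qd/n; the other half gives the bound.\<close>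

lemma expanding_term_le:
  fixes n d q :: nat
  assumes n: "0 < n" and d: "8 \<le> d" and q: "0 < q" and small: "14 ^ 4 * (real (q * d) / real n) \<le> 1 / 4"
    and large: "3 * 14 ^ 4 * real d * (1 / 4) powr (real d / 8 - 1) \<le> 1"
  shows "real (n choose q) * (14 ^ 4 * (real (q * d) / real n)) powr (real (q * d) / 4)
    \<le> (14 ^ 4 * (real d / real n)) powr (real d / 8) * (1 / 2) ^ (q - 1)"
proof -
  define u where "u = 14 ^ 4 * (real (q * d) / real n)"
  define \<delta> where "\<delta> = 14 ^ 4 * (real d / real n)"
  have u: "0 < u" "u \<le> 1 / 4" unfolding u_def using n d q small by auto
  have \<delta>: "0 < \<delta>" and u\<delta>: "u = real q * \<delta>" unfolding u_def \<delta>_def using n d by auto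
  have "3 * real n / real q = 3 * 14 ^ 4 * real d / u"
    unfolding u_def using n d q by (simp add: field_simps)
  then have "real (n choose q) \<le> (3 * 14 ^ 4 * real d / u) ^ q"
    using binomial_le_three_pow[OF q, of n] by simp
  moreover have "u powr (real (q * d) / 4) = (u powr (real d / 8) * u powr (real d / 8)) ^ q"
    unfolding powr_add[symmetric] using u by (simp add: powr_realpow[symmetric] powr_powr mult.commute)
  ultimately have "real (n choose q) * u powr (real (q * d) / 4)
      \<le> (3 * 14 ^ 4 * real d / u) ^ q * (u powr (real d / 8) * u powr (real d / 8)) ^ q"
    by (simp add: mult_right_mono)
  also have "\<dots> = ((3 * 14 ^ 4 * real d * u powr (real d / 8 - 1)) * u powr (real d / 8)) ^ q"
    unfolding power_mult_distrib[symmetric] using u by (simp add: powr_diff mult.assoc)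
  also have "\<dots> \<le> (1 * u powr (real d / 8)) ^ q"
  proof (intro power_mono mult_right_mono)
    have "u powr (real d / 8 - 1) \<le> (1 / 4) powr (real d / 8 - 1)"
      using u d by (intro powr_mono2) auto
    then have "3 * 14 ^ 4 * real d * u powr (real d / 8 - 1) \<le> 3 * 14 ^ 4 * real d * (1 / 4) powr (real d / 8 - 1)"
      by (intro mult_left_mono) auto
    then show "3 * 14 ^ 4 * real d * u powr (real d / 8 - 1) \<le> 1" using large by linarith
  qed auto
  also have "\<dots> = (u ^ q) powr (real d / 8)"
    using u by (simp add: powr_realpow[symmetric] powr_powr mult.commute)
  also have "\<dots> \<le> (\<delta> * (1 / 2) ^ (q - 1)) powr (real d / 8)"
  proof (intro powr_mono2)
    \<comment> \<open>One factor u = q\<delta> is kept, the rest are bounded by 1/4. Half of that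
      decay cancels q; the other half makes the sum over q geometric.\<close>
    have "u ^ q = real q * \<delta> * u ^ (q - 1)"
      using q u\<delta> by (cases q) auto
    also have "\<dots> \<le> real q * \<delta> * (1 / 4) ^ (q - 1)"
      using u \<delta> by (intro mult_left_mono power_mono) auto
    also have "(1 / 4 :: real) ^ (q - 1) = (1 / 2) ^ (q - 1) * (1 / 2) ^ (q - 1)"
      unfolding power_mult_distrib[symmetric] by simp
    also have "real q * \<delta> * ((1 / 2) ^ (q - 1) * (1 / 2) ^ (q - 1))
        = \<delta> * (1 / 2) ^ (q - 1) * (real q / 2 ^ (q - 1))"
      by (simp add: power_divide)
    also have "\<dots> \<le> \<delta> * (1 / 2) ^ (q - 1) * 1"
    proof (intro mult_left_mono)
      have "q - 1 < 2 ^ (q - 1)" by (rule less_exp)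
      then have "q \<le> 2 ^ (q - 1)" by linarith
      then have "real q \<le> real (2 ^ (q - 1))" by (rule of_nat_mono)
      then show "real q / 2 ^ (q - 1) \<le> 1" by simp
    qed (use \<delta> in auto)
    finally show "u ^ q \<le> \<delta> * (1 / 2) ^ (q - 1)" by simp
  qed (use u in auto)
  also have "\<dots> = \<delta> powr (real d / 8) * ((1 / 2) ^ (q - 1)) powr (real d / 8)"
    by (rule powr_mult)
  also have "\<dots> \<le> \<delta> powr (real d / 8) * ((1 / 2) ^ (q - 1)) powr 1"
    using d by (intro mult_left_mono powr_mono') (auto simp: power_le_one)
  also have "((1 / 2 :: real) ^ (q - 1)) powr 1 = (1 / 2) ^ (q - 1)" by simp
  finally show ?thesis unfolding u_def \<delta>_def .
qed

text \<open>The same splitting of the exponent; here n/m is at most a constant times d, so one half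
  absorbs the choice of \<open>J\<close>.\<close>

lemma double_hits_term_le:
  fixes n d m :: nat
  assumes n: "0 < n" and d: "0 < d" "192 * d \<le> n" and m: "0 < m" "n \<le> 8 * 14 ^ 4 * (m * d)"
    and large: "24 * 14 ^ 4 * real d * (1 / 4) powr (real d / 16) \<le> 1"
  shows "real (n choose m) * (48 * (real d / real n)) powr (real (m * d) / 8)
    \<le> (14 ^ 4 * (real d / real n)) powr (real d / 16)"
proof -
  define v where "v = 48 * (real d / real n)"
  have "real (192 * d) \<le> real n" using d(2) by (rule of_nat_mono)
  then have v: "0 < v" "v \<le> 1 / 4" unfolding v_def using n d by (auto simp: field_simps)
  have "real n \<le> real (8 * 14 ^ 4 * (m * d))" using m(2) by (rule of_nat_mono)
  then have "3 * real n / real m \<le> 24 * 14 ^ 4 * real d"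
    using m(1) by (simp add: field_simps)
  then have "(3 * real n / real m) ^ m \<le> (24 * 14 ^ 4 * real d) ^ m"
    by (intro power_mono) auto
  then have "real (n choose m) \<le> (24 * 14 ^ 4 * real d) ^ m"
    using binomial_le_three_pow[OF m(1), of n] by linarith
  moreover have "v powr (real (m * d) / 8) = (v powr (real d / 16) * v powr (real d / 16)) ^ m"
    unfolding powr_add[symmetric] using v by (simp add: powr_realpow[symmetric] powr_powr mult.commute)
  ultimately have "real (n choose m) * v powr (real (m * d) / 8)
      \<le> (24 * 14 ^ 4 * real d) ^ m * (v powr (real d / 16) * v powr (real d / 16)) ^ m"
    by (simp add: mult_right_mono)
  also have "\<dots> = ((24 * 14 ^ 4 * real d * v powr (real d / 16)) * v powr (real d / 16)) ^ m"
    unfolding power_mult_distrib[symmetric] by (simp only: mult.assoc)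
  also have "\<dots> \<le> (1 * v powr (real d / 16)) ^ m"
  proof (intro power_mono mult_right_mono)
    have "v powr (real d / 16) \<le> (1 / 4) powr (real d / 16)"
      using v by (intro powr_mono2) auto
    then have "24 * 14 ^ 4 * real d * v powr (real d / 16) \<le> 24 * 14 ^ 4 * real d * (1 / 4) powr (real d / 16)"
      by (intro mult_left_mono) auto
    then show "24 * 14 ^ 4 * real d * v powr (real d / 16) \<le> 1" using large by linarith
  qed auto
  also have "\<dots> \<le> (1 * v powr (real d / 16)) ^ 1"
    using m v by (intro power_decreasing) (auto simp: powr_le1)
  also have "\<dots> \<le> (14 ^ 4 * (real d / real n)) powr (real d / 16)"
    using v unfolding v_def by (auto intro!: powr_mono2 divide_right_mono)
  finally show ?thesis unfolding v_def .
qed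

text \<open>Entropy against independence. The two families of sets cost at most
  \<open>exp (c\<^sub>0 / 256 * real n)\<close>; at least c0 n/32 independent pairs, each
  contributing 3/4 \<le> exp(-1/4), gain \<open>exp (- (c\<^sub>0 / 128 * real n))\<close>.\<close>

lemma spread_kernel_term_le:
  fixes n h k g :: nat and c c\<^sub>0 :: real
  assumes c0: "0 < c\<^sub>0" "c\<^sub>0 \<le> 1" and c: "0 < c" "c \<le> c\<^sub>0 / 128" "c * ln (1024 / c\<^sub>0) \<le> c\<^sub>0 / 2048"
    and n: "1 \<le> c * real n" and h: "h \<le> n" and k: "real k \<le> c * real n"
    and g: "c\<^sub>0 * real n / 16 - 1 - real k \<le> real g"
  shows "real (card {J. J \<subseteq> {..<n} \<and> card J \<le> k}) * real (card {P. P \<subseteq> {..<h} \<and> card P \<le> k + 1})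
      * (3 / 4) ^ (g - (k + 1)) \<le> exp (- (c\<^sub>0 / 256 * real n))"
proof -
  \<comment> \<open>Small enough that the two factors exp(tn) use only half of the allowance; the
    condition on c ln(1024/c0) pays for the 2k + 1 \<le> 3cn powers of 1/t.\<close>
  define t where "t = c\<^sub>0 / 1024"
  have t: "0 < t" "t \<le> 1" using c0 unfolding t_def by auto
  have "real (card {J. J \<subseteq> {..<n} \<and> card J \<le> k}) \<le> (1 / t) ^ k * exp (t * real n)"
    using card_small_subsets_le[of "{..<n}" t k] t by simp
  moreover have "real (card {P. P \<subseteq> {..<h} \<and> card P \<le> k + 1}) \<le> (1 / t) ^ (k + 1) * exp (t * real n)"
  proof -
    have "real (card {P. P \<subseteq> {..<h} \<and> card P \<le> k + 1}) \<le> (1 / t) ^ (k + 1) * exp (t * real h)"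
      using card_small_subsets_le[of "{..<h}" t "k + 1"] t by simp
    also have "\<dots> \<le> (1 / t) ^ (k + 1) * exp (t * real n)"
      using t h by (intro mult_left_mono) auto
    finally show ?thesis .
  qed
  ultimately have "real (card {J. J \<subseteq> {..<n} \<and> card J \<le> k}) * real (card {P. P \<subseteq> {..<h} \<and> card P \<le> k + 1})
      \<le> ((1 / t) ^ k * exp (t * real n)) * ((1 / t) ^ (k + 1) * exp (t * real n))"
    using t by (intro mult_mono) auto
  also have "\<dots> = (1 / t) ^ (k + (k + 1)) * exp (2 * (t * real n))"
    unfolding power_add mult_2 exp_add by (simp only: ac_simps)
  also have "(1 / t) ^ (k + (k + 1)) = exp (ln (1 / t) * real (k + (k + 1)))"
    using t by (simp only: exp_of_nat2_mult) (simp add: exp_ln)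
  also have "exp (ln (1 / t) * real (k + (k + 1))) * exp (2 * (t * real n)) \<le> exp (c\<^sub>0 / 256 * real n)"
  proof -
    have "ln (1 / t) * real (k + (k + 1)) \<le> ln (1 / t) * (3 * (c * real n))"
      using t k n by (intro mult_left_mono ln_ge_zero) auto
    also have "\<dots> = 3 * (c * ln (1024 / c\<^sub>0)) * real n" unfolding t_def by simp
    also have "\<dots> \<le> 3 * (c\<^sub>0 / 2048) * real n"
      using c(3) by (intro mult_right_mono mult_left_mono) auto
    finally have "ln (1 / t) * real (k + (k + 1)) \<le> 3 * (c\<^sub>0 / 2048) * real n" .
    moreover have "t * real n = c\<^sub>0 / 1024 * real n" "0 \<le> c\<^sub>0 * real n"
      unfolding t_def using c0 by auto
    ultimately have "ln (1 / t) * real (k + (k + 1)) + 2 * (t * real n) \<le> c\<^sub>0 / 256 * real n"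
      by linarith
    then show ?thesis unfolding exp_add[symmetric] exp_le_cancel_iff .
  qed
  finally have sets: "real (card {J. J \<subseteq> {..<n} \<and> card J \<le> k}) * real (card {P. P \<subseteq> {..<h} \<and> card P \<le> k + 1})
      \<le> exp (c\<^sub>0 / 256 * real n)" .
  have "(3 / 4 :: real) ^ (g - (k + 1)) \<le> exp (- (1 / 4)) ^ (g - (k + 1))"
    using exp_ge_add_one_self[of "- (1 / 4) :: real"] by (intro power_mono) auto
  also have "\<dots> = exp (- (1 / 4) * real (g - (k + 1)))"
    by (rule exp_of_nat2_mult[symmetric])
  also have "\<dots> \<le> exp (- (c\<^sub>0 / 128 * real n))"
  proof -
    have cn: "c * real n \<le> c\<^sub>0 / 128 * real n" using c by (intro mult_right_mono) auto
    have "real g - real (k + 1) \<le> real (g - (k + 1))" by simp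
    then have "c\<^sub>0 * real n / 16 - 2 - 2 * real k \<le> real (g - (k + 1))" using g by simp
    then have "c\<^sub>0 * real n / 16 - 4 * (c\<^sub>0 / 128 * real n) \<le> real (g - (k + 1))"
      using k n cn by linarith
    then show ?thesis by simp
  qed
  finally have "(3 / 4 :: real) ^ (g - (k + 1)) \<le> exp (- (c\<^sub>0 / 128 * real n))" .
  with sets have "real (card {J. J \<subseteq> {..<n} \<and> card J \<le> k}) * real (card {P. P \<subseteq> {..<h} \<and> card P \<le> k + 1})
      * (3 / 4) ^ (g - (k + 1)) \<le> exp (c\<^sub>0 / 256 * real n) * exp (- (c\<^sub>0 / 128 * real n))"
    by (intro mult_mono) auto
  also have "\<dots> = exp (- (c\<^sub>0 / 256 * real n))"
    unfolding exp_add[symmetric] by simp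
  finally show ?thesis .
qed

text \<open>Each of the two terms is at most a quarter of the target. Half of the exponent d/16
  already yields 1/16 since d \<ge> 64, and the other half is below the target. The exponential term
  is compared through d ln(n/d) \<le> n, with the gap between \<kappa> and c providing the factor
  1/4.\<close>

lemma final_bound:
  fixes n d :: nat and C c \<kappa> :: real
  assumes n: "0 < n" and d: "64 \<le> d" and c: "0 < c" "c \<le> 1 / 32" "c \<le> \<kappa> / 6" "real d \<le> c * real n"
    and C: "14 ^ 4 \<le> C" and \<delta>: "14 ^ 4 * (real d / real n) \<le> 1 / 4"
  shows "4 * (14 ^ 4 * (real d / real n)) powr (real d / 16) + exp (- (\<kappa> * real n))
    \<le> 1 / 2 * (C * real d / real n) powr (c * real d)"
proof -
  define \<delta> where "\<delta> = 14 ^ 4 * (real d / real n)"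
  define q where "q = (C * real d / real n) powr (c * real d)"
  have \<delta>0: "0 < \<delta>" "\<delta> \<le> 1 / 4" using n d assms(8) unfolding \<delta>_def by auto
  have "\<delta> powr (real d / 32) \<le> \<delta> powr (c * real d)"
    using \<delta>0 c(2) d by (intro powr_mono') (auto simp: field_simps)
  also have "\<dots> \<le> q"
    unfolding q_def
  proof (rule powr_mono2)
    show "\<delta> \<le> C * real d / real n"
      unfolding \<delta>_def using C by (simp add: divide_right_mono mult_right_mono)
  qed (use \<delta>0 c in auto)
  finally have \<delta>q: "\<delta> powr (real d / 32) \<le> q" .
  have "\<delta> powr (real d / 32) \<le> (1 / 4) powr (real d / 32)"
    using \<delta>0 by (intro powr_mono2) auto
  also have "\<dots> \<le> (1 / 4) powr 2"
    using d by (intro powr_mono') auto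
  also have "\<dots> = (1 / 16 :: real)" by (simp add: power2_eq_square)
  finally have "\<delta> powr (real d / 32) * \<delta> powr (real d / 32) \<le> 1 / 16 * q"
    using \<delta>q by (intro mult_mono) auto
  then have 1: "\<delta> powr (real d / 16) \<le> 1 / 16 * q"
    unfolding powr_add[symmetric] by simp
  have cn: "64 \<le> c * real n" using c(4) d by linarith
  have \<kappa>: "6 * (c * real n) \<le> \<kappa> * real n"
    using mult_right_mono[OF c(3), of "real n"] by simp
  have "c * (real d * ln (real n / real d)) \<le> c * real n"
  proof (intro mult_left_mono)
    have "ln (real n / real d) \<le> real n / real d"
      using n d ln_le_minus_one[of "real n / real d"] by simp
    then have "real d * ln (real n / real d) \<le> real d * (real n / real d)"
      by (intro mult_left_mono) auto
    then show "real d * ln (real n / real d) \<le> real n" using d by simp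
  qed (use c in auto)
  then have "exp (- (c * real n)) \<le> exp (- (c * (real d * ln (real n / real d))))" by simp
  also have "\<dots> = (real d / real n) powr (c * real d)"
    using n d by (simp add: powr_def ln_div algebra_simps)
  also have "\<dots> \<le> q"
    unfolding q_def
  proof (rule powr_mono2)
    have "1 * real d / real n \<le> C * real d / real n"
      using C by (intro divide_right_mono mult_right_mono) auto
    then show "real d / real n \<le> C * real d / real n" by simp
  qed (use c in auto)
  finally have "exp (- (c * real n)) \<le> q" .
  moreover have "exp (- (\<kappa> * real n)) \<le> 1 / 4 * exp (- (c * real n))"
  proof -
    have "4 \<le> exp (\<kappa> * real n - c * real n)"
      using exp_ge_add_one_self[of "\<kappa> * real n - c * real n"] \<kappa> cn by linarith
    then have "4 * exp (- (\<kappa> * real n)) \<le> exp (\<kappa> * real n - c * real n) * exp (- (\<kappa> * real n))"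
      by (intro mult_right_mono) auto
    also have "\<dots> = exp (- (c * real n))" unfolding exp_add[symmetric] by simp
    finally show ?thesis by simp
  qed
  ultimately have "exp (- (\<kappa> * real n)) \<le> 1 / 4 * q" by linarith
  then show ?thesis using 1 unfolding \<delta>_def q_def by linarith
qed

section \<open>Choice of the constants\<close>

lemma card_null_vector_bound:
  "\<exists>C c :: real. C > 0 \<and> c > 0 \<and> c \<le> 1 \<and> 3 \<le> C \<and> (\<forall>n d k :: nat. C \<le> real d \<longrightarrow> real d \<le> c * real n \<longrightarrow> real k \<le> c * real n \<longrightarrow>
     real (card {E \<in> reg n d. null_vector n k E})
       \<le> 1 / 2 * (C * real d / real n) powr (c * real d) * real (card (reg n d)))"
proof -
  have "eventually (\<lambda>d :: real. 3 * 14 ^ 4 * d * (1 / 4) powr (d / 8 - 1) \<le> 1) at_top"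
    by real_asymp
  moreover have "eventually (\<lambda>d :: real. 24 * 14 ^ 4 * d * (1 / 4) powr (d / 16) \<le> 1) at_top"
    by real_asymp
  ultimately have "eventually (\<lambda>d :: real. 3 * 14 ^ 4 * d * (1 / 4) powr (d / 8 - 1) \<le> 1 \<and>
      24 * 14 ^ 4 * d * (1 / 4) powr (d / 16) \<le> 1) at_top"
    by (rule eventually_conj)
  then obtain D :: real where D1: "\<And>d. D \<le> d \<Longrightarrow> 3 * 14 ^ 4 * d * (1 / 4) powr (d / 8 - 1) \<le> 1"
    and D2: "\<And>d. D \<le> d \<Longrightarrow> 24 * 14 ^ 4 * d * (1 / 4) powr (d / 16) \<le> 1"
    unfolding eventually_at_top_linorder by blast
  define C where "C = max D (14 ^ 4)"
  \<comment> \<open>Makes 14^4 qd/n \<le> 1/4 whenever qd \<le> c0 n, the smallness required for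
    expansion.\<close>
  define c\<^sub>0 :: real where "c\<^sub>0 = 1 / (4 * 14 ^ 4)"
  define \<kappa> where "\<kappa> = c\<^sub>0 / 256"
  have c0: "0 < c\<^sub>0" "c\<^sub>0 \<le> 1" unfolding c\<^sub>0_def by auto
  have L: "0 < ln (1024 / c\<^sub>0)" using c0 by (intro ln_gt_zero) (auto simp: field_simps)
  \<comment> \<open>The first entry controls the entropy of the sets of size at most cn. The second
    serves the final comparison and makes c0 n/d at least 1536, so that m \<ge> 2.\<close>
  define c where "c = min (c\<^sub>0 / 2048 / ln (1024 / c\<^sub>0)) (\<kappa> / 6)"
  have c: "0 < c" "c \<le> \<kappa> / 6" unfolding c_def \<kappa>_def using c0 L by auto
  have "c \<le> c\<^sub>0 / 2048 / ln (1024 / c\<^sub>0)" unfolding c_def by simp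
  then have c1: "c * ln (1024 / c\<^sub>0) \<le> c\<^sub>0 / 2048" using L by (simp add: field_simps)
  have c2: "c \<le> c\<^sub>0 / 1536" using c unfolding \<kappa>_def by simp
  then have c3: "c \<le> c\<^sub>0 / 128" "c \<le> 1 / 32" using c0 by linarith+
  show ?thesis
  proof (rule exI[of _ C], rule exI[of _ c], intro conjI allI impI)
    fix n d k :: nat
    assume dC: "C \<le> real d" and dn: "real d \<le> c * real n" and kn: "real k \<le> c * real n"
    have d: "14 ^ 4 \<le> real d" "D \<le> real d" using dC unfolding C_def by auto
    then have d': "64 \<le> d" by (simp add: C_def)
    have n: "0 < n" using dn d' c by (cases n) auto
    have "c * real n \<le> c\<^sub>0 / 1536 * real n" using c2 by (intro mult_right_mono) auto
    then have dn0: "1536 * real d \<le> c\<^sub>0 * real n" and kn0: "1536 * real k \<le> c\<^sub>0 * real n"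
      using dn kn by linarith+
    \<comment> \<open>The largest size with md \<le> c0 n. Rounding down costs less than one d, so
      md is still at least c0 n/2.\<close>
    define m where "m = nat \<lfloor>c\<^sub>0 * real n / real d\<rfloor>"
    have ratio: "1536 \<le> c\<^sub>0 * real n / real d" using dn0 d' by (simp add: field_simps)
    then have m_le: "real m \<le> c\<^sub>0 * real n / real d" and m_gt: "c\<^sub>0 * real n / real d < real m + 1"
      unfolding m_def by linarith+
    have m: "2 \<le> m" using m_gt ratio by linarith
    have md_le: "real (m * d) \<le> c\<^sub>0 * real n" using m_le d' by (simp add: field_simps)
    have "c\<^sub>0 * real n < (real m + 1) * real d" using m_gt d' by (simp add: field_simps)
    then have md_ge: "c\<^sub>0 * real n / 2 \<le> real (m * d)" using dn0 by (simp add: algebra_simps)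
    have cn_small: "4 * c\<^sub>0 * real n \<le> real n" using c0 n unfolding c\<^sub>0_def by simp
    have "real (m * d) < real n" using md_le cn_small n by linarith
    then have md: "m * d < n" by (rule of_nat_less_iff[THEN iffD1])
    have "2 * 64 \<le> m * d" using m d' by (rule mult_le_mono)
    then have md4: "4 \<le> m * d" by simp
    have small: "14 ^ 4 * (real (q * d) / real n) \<le> 1 / 4" if "q \<le> m" for q
    proof -
      have "real (q * d) \<le> real (m * d)" using that by (intro of_nat_mono) simp
      then have "real (q * d) \<le> c\<^sub>0 * real n" using md_le by linarith
      then show ?thesis unfolding c\<^sub>0_def using n by (simp add: field_simps)
    qed
    have n8: "real (1536 * 4 * 14 ^ 4 * d) \<le> real n"
      using dn0 unfolding c\<^sub>0_def by (simp add: field_simps)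
    then have "1536 * 4 * 14 ^ 4 * d \<le> n" by (rule of_nat_le_iff[THEN iffD1])
    then have d8: "8 * d \<le> n" "48 * d \<le> n" "192 * d \<le> n" by auto
    define \<delta> where "\<delta> = 14 ^ 4 * (real d / real n)"
    have \<delta>: "0 < \<delta>" "\<delta> \<le> 1 / 4" using small[of 1] m d' n unfolding \<delta>_def by auto
    define R where "R = real (card (reg n d))"
    have R: "0 \<le> R" unfolding R_def by simp
    define X where "X q = {E \<in> reg n d. \<exists>J \<subseteq> {..<n}. card J = q \<and> 4 * card (E\<inverse> `` J) \<le> 3 * (q * d)}" for q
    have X: "real (card (X q)) \<le> \<delta> powr (real d / 8) * R * (1 / 2) ^ (q - 1)" if q: "0 < q" "q \<le> m" for q
    proof -
      have "q * d \<le> m * d" using q by simp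
      then have qd: "q * d \<le> n" using md by linarith
      have "real (card (X q)) \<le> real (n choose q) * (14 ^ 4 * (real (q * d) / real n)) powr (real (q * d) / 4) * R"
        unfolding X_def R_def using d' d8(1) q(1) qd by (intro card_nonexpanding_le) auto
      also have "\<dots> \<le> (\<delta> powr (real d / 8) * (1 / 2) ^ (q - 1)) * R"
        unfolding \<delta>_def using n d' q small[OF q(2)] D1[OF d(2)] R
        by (intro mult_right_mono expanding_term_le) auto
      finally show ?thesis by (simp only: ac_simps)
    qed
    \<comment> \<open>The subtraction is not truncated, since k is at most md/8.\<close>
    define g where "g = (m * d) div 8 - k"
    have g8: "8 * (g + k) \<le> m * d"
    proof -
      have "8 * real k \<le> real (m * d)" using kn0 md_ge by linarith
      then have "real (8 * k) \<le> real (m * d)" by simp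
      then have "8 * k \<le> m * d" by (rule of_nat_le_iff[THEN iffD1])
      then have "k \<le> (m * d) div 8" by (simp add: less_eq_div_iff_mult_less_eq mult.commute)
      then have "g + k = (m * d) div 8" unfolding g_def by simp
      then show ?thesis by (simp only: times_div_less_eq_dividend)
    qed
    have g_ge: "c\<^sub>0 * real n / 16 - 1 - real k \<le> real g"
    proof -
      have "(m * d) div 8 \<le> g + k" unfolding g_def by simp
      moreover have "m * d < 8 * ((m * d) div 8) + 8" by (rule dividend_less_times_div[of 8, THEN order.strict_trans2]) simp_all
      ultimately have "m * d \<le> 8 * (g + k) + 8" by simp
      then have "real (m * d) \<le> real (8 * (g + k) + 8)" by (rule of_nat_mono)
      then show ?thesis using md_ge by simp
    qed
    have "(\<Sum>q\<in>{1..m}. real (card (X q))) \<le> (\<Sum>q\<in>{1..m}. \<delta> powr (real d / 8) * R * (1 / 2) ^ (q - 1))"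
      using X by (intro sum_mono) auto
    also have "\<dots> = \<delta> powr (real d / 8) * R * (\<Sum>q\<in>{1..m}. (1 / 2) ^ (q - 1))"
      by (simp only: sum_distrib_left)
    also have "(\<Sum>q\<in>{1..m}. (1 / 2 :: real) ^ (q - 1)) = (\<Sum>q<m. (1 / 2) ^ q)"
      by (rule sum.reindex_bij_witness[of _ Suc "\<lambda>q. q - 1"]) auto
    also have "(\<Sum>q<m. (1 / 2 :: real) ^ q) = 2 - 2 * (1 / 2) ^ m"
      by (subst geometric_sum) (auto simp: field_simps)
    also have "\<delta> powr (real d / 8) * R * (2 - 2 * (1 / 2) ^ m) \<le> \<delta> powr (real d / 8) * R * 2"
      using R by (intro mult_left_mono) auto
    finally have XS: "(\<Sum>q\<in>{1..m}. real (card (X q))) \<le> 2 * \<delta> powr (real d / 8) * R" by simp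
    have "\<delta> powr (real d / 8) * R * (1 / 2) ^ (2 - 1) \<le> \<delta> powr (real d / 8) * R * 1"
      using R by (intro mult_left_mono) auto
    then have X2: "real (card (X 2)) \<le> \<delta> powr (real d / 8) * R"
      using X[of 2] m by linarith
    have Dh: "real (card {E \<in> reg n d. \<exists>J \<subseteq> {..<n}. card J = m \<and> m * d \<le> 8 * card (double_hits (n div 2) E J)})
        \<le> \<delta> powr (real d / 16) * R"
    proof -
      have "real (card {E \<in> reg n d. \<exists>J \<subseteq> {..<n}. card J = m \<and> m * d \<le> 8 * card (double_hits (n div 2) E J)})
          \<le> real (n choose m) * (48 * (real d / real n)) powr (real (m * d) / 8) * R"
        unfolding R_def using d' d8 m md by (intro card_double_hits_ge_le) auto
      also have "\<dots> \<le> \<delta> powr (real d / 16) * R"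
      proof -
        have "real n \<le> 8 * 14 ^ 4 * real (m * d)" using md_ge unfolding c\<^sub>0_def by simp
        then have "real n \<le> real (8 * 14 ^ 4 * (m * d))" by simp
        then have "n \<le> 8 * 14 ^ 4 * (m * d)" by (rule of_nat_le_iff[THEN iffD1])
        then show ?thesis
          unfolding \<delta>_def using n d' d8 m D2[OF d(2)] R
          by (intro mult_right_mono double_hits_term_le) auto
      qed
      finally show ?thesis .
    qed
    have Sp: "real (card {E \<in> reg n d. many_split_pairs n (n div 2) m k g (row_diff (n div 2) E) \<and> spread_kernel n m k (\<lambda>i. E `` {i})})
        \<le> exp (- (\<kappa> * real n)) * R"
    proof -
      have "1 \<le> c * real n" using dn d' by linarith
      then have "real (card {J. J \<subseteq> {..<n} \<and> card J \<le> k}) * real (card {P. P \<subseteq> {..<n div 2} \<and> card P \<le> k + 1})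
          * (3 / 4) ^ (g - (k + 1)) \<le> exp (- (c\<^sub>0 / 256 * real n))"
        using c0 c c1 c3 kn g_ge by (intro spread_kernel_term_le[of c\<^sub>0 c]) auto
      then have "real (card {J. J \<subseteq> {..<n} \<and> card J \<le> k}) * real (card {P. P \<subseteq> {..<n div 2} \<and> card P \<le> k + 1})
          * (3 / 4) ^ (g - (k + 1)) * R \<le> exp (- (c\<^sub>0 / 256 * real n)) * R"
        using R by (rule mult_right_mono)
      moreover have "2 * (n div 2) \<le> n" by simp
      ultimately show ?thesis
        unfolding \<kappa>_def R_def using card_spread_kernel_le[of "n div 2" n d m k g] by linarith
    qed
    have "card {E \<in> reg n d. null_vector n k E}
      \<le> (\<Sum>q\<in>{1..m}. card (X q)) + card (X 2)
      + card {E \<in> reg n d. \<exists>J \<subseteq> {..<n}. card J = m \<and> m * d \<le> 8 * card (double_hits (n div 2) E J)}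
      + card {E \<in> reg n d. many_split_pairs n (n div 2) m k g (row_diff (n div 2) E) \<and> spread_kernel n m k (\<lambda>i. E `` {i})}"
      unfolding X_def using d' md md4 g8 by (intro card_null_vector_le) auto
    then have "real (card {E \<in> reg n d. null_vector n k E})
      \<le> (\<Sum>q\<in>{1..m}. real (card (X q))) + real (card (X 2))
      + real (card {E \<in> reg n d. \<exists>J \<subseteq> {..<n}. card J = m \<and> m * d \<le> 8 * card (double_hits (n div 2) E J)})
      + real (card {E \<in> reg n d. many_split_pairs n (n div 2) m k g (row_diff (n div 2) E) \<and> spread_kernel n m k (\<lambda>i. E `` {i})})"
      by (simp only: of_nat_sum[symmetric] of_nat_add[symmetric] of_nat_le_iff)
    also have "\<dots> \<le> 2 * \<delta> powr (real d / 8) * R + \<delta> powr (real d / 8) * R + \<delta> powr (real d / 16) * R + exp (- (\<kappa> * real n)) * R"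
      using XS X2 Dh Sp by linarith
    \<comment> \<open>The 3 combines 2 from the geometric sum over sizes and 1 from the expansion of
      two rows.\<close>
    also have "\<dots> = (3 * \<delta> powr (real d / 8) + \<delta> powr (real d / 16) + exp (- (\<kappa> * real n))) * R"
      by (simp add: algebra_simps)
    also have "\<dots> \<le> (4 * \<delta> powr (real d / 16) + exp (- (\<kappa> * real n))) * R"
    proof (intro mult_right_mono R)
      have "\<delta> powr (real d / 8) \<le> \<delta> powr (real d / 16)" using \<delta> by (intro powr_mono') auto
      then show "3 * \<delta> powr (real d / 8) + \<delta> powr (real d / 16) + exp (- (\<kappa> * real n))
          \<le> 4 * \<delta> powr (real d / 16) + exp (- (\<kappa> * real n))" by linarith
    qed
    also have "\<dots> \<le> (1 / 2 * (C * real d / real n) powr (c * real d)) * R"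
    proof (intro mult_right_mono R)
      show "4 * \<delta> powr (real d / 16) + exp (- (\<kappa> * real n)) \<le> 1 / 2 * (C * real d / real n) powr (c * real d)"
        using final_bound[OF n d' c(1) c3(2) c(2) dn, of C] \<delta>(2) unfolding \<delta>_def C_def by simp
    qed
    finally show "real (card {E \<in> reg n d. null_vector n k E})
       \<le> 1 / 2 * (C * real d / real n) powr (c * real d) * real (card (reg n d))"
      unfolding R_def .
  qed (use c c3 in \<open>auto simp: C_def\<close>)
qed

section \<open>Matrices\<close>

text \<open>The circulant graph with shifts 0, ..., d - 1 is a witness. It makes division by the
  number of matrices legitimate.\<close>

lemma reg_nonempty:
  assumes "d \<le> n"
  shows "reg n d \<noteq> {}"
proof -
  define E where "E = {(i, j). i < n \<and> j < n \<and> (\<exists>t<d. j = (i + t) mod n)}"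
  have shift: "inj_on (\<lambda>t. (i + t) mod n) {..<d}" for i
  proof (rule inj_onI)
    fix s t assume st: "s \<in> {..<d}" "t \<in> {..<d}" and "(i + s) mod n = (i + t) mod n"
    then have "s mod n = t mod n" by (simp add: mod_add_left_eq nat_mod_eq_iff)
    then show "s = t" using st assms by simp
  qed
  have row: "card (E `` {i}) = d" if "i < n" for i
  proof -
    have "E `` {i} = (\<lambda>t. (i + t) mod n) ` {..<d}"
      using that unfolding E_def by auto
    then show ?thesis using card_image[OF shift] by simp
  qed
  have col: "card (E\<inverse> `` {j}) = d" if j: "j < n" for j
  proof -
    \<comment> \<open>The shift is inverted by adding \<open>n - t\<close>, which avoids negative
      numbers.\<close>
    have eq: "j = (i + t) mod n \<longleftrightarrow> i = (j + (n - t)) mod n" if "i < n" "t < d" for i t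
    proof -
      have t: "t < n" using that assms by simp
      then show ?thesis using j that
        by (cases "i + t < n"; cases "t \<le> j") (auto simp: mod_if)
    qed
    have "E\<inverse> `` {j} = (\<lambda>t. (j + (n - t)) mod n) ` {..<d}"
      using j eq unfolding E_def by (auto 4 4)
    moreover have "inj_on (\<lambda>t. (j + (n - t)) mod n) {..<d}"
    proof (rule inj_onI)
      fix s t assume st: "s \<in> {..<d}" "t \<in> {..<d}" and e: "(j + (n - s)) mod n = (j + (n - t)) mod n"
      define i where "i = (j + (n - s)) mod n"
      have i: "i < n" unfolding i_def using j by simp
      have "j = (i + s) mod n" "j = (i + t) mod n"
        using eq[OF i] st e i_def by auto
      then have "(i + s) mod n = (i + t) mod n" by simp
      then show "s = t" using inj_onD[OF shift] st by blast
    qed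
    ultimately show ?thesis using card_image by fastforce
  qed
  have "E \<in> reg n d" unfolding reg_def using row col by (auto simp: E_def)
  then show ?thesis by blast
qed

definition adj_mat :: "nat \<Rightarrow> (nat \<times> nat) set \<Rightarrow> real mat" where
  "adj_mat n E = mat n n (\<lambda>(i, j). of_bool ((i, j) \<in> E))"

lemma bij_betw_adj_mat: "bij_betw (adj_mat n) (reg n d) (regular_01_mats n d)"
proof (rule bij_betwI[where g = "\<lambda>M. {(i, j). i < n \<and> j < n \<and> M $$ (i, j) = 1}"])
  show "adj_mat n \<in> reg n d \<rightarrow> regular_01_mats n d"
  proof
    fix E assume E: "E \<in> reg n d"
    have "{j. j < n \<and> adj_mat n E $$ (i, j) = 1} = E `` {i}" if "i < n" for i
      using that reg_Image_subset(1)[OF E, of "{i}"] unfolding adj_mat_def by auto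
    moreover have "{i. i < n \<and> adj_mat n E $$ (i, j) = 1} = E\<inverse> `` {j}" if "j < n" for j
      using that reg_Image_subset(2)[OF E, of "{j}"] unfolding adj_mat_def by auto
    ultimately show "adj_mat n E \<in> regular_01_mats n d"
      unfolding regular_01_mats_def using reg_row[OF E] reg_col[OF E]
      by (auto simp: adj_mat_def)
  qed
  show "(\<lambda>M. {(i, j). i < n \<and> j < n \<and> M $$ (i, j) = 1}) \<in> regular_01_mats n d \<rightarrow> reg n d"
  proof
    fix M assume M: "M \<in> regular_01_mats n d"
    let ?E = "{(i, j). i < n \<and> j < n \<and> M $$ (i, j) = 1}"
    have "?E `` {i} = {j. j < n \<and> M $$ (i, j) = 1}" if "i < n" for i using that by auto
    moreover have "?E\<inverse> `` {j} = {i. i < n \<and> M $$ (i, j) = 1}" if "j < n" for j using that by auto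
    ultimately show "?E \<in> reg n d"
      using M unfolding reg_def regular_01_mats_def by auto
  qed
  show "{(i, j). i < n \<and> j < n \<and> adj_mat n E $$ (i, j) = 1} = E" if "E \<in> reg n d" for E
    using reg_subset[OF that] unfolding adj_mat_def by auto
  show "adj_mat n {(i, j). i < n \<and> j < n \<and> M $$ (i, j) = 1} = M" if "M \<in> regular_01_mats n d" for M
  proof (rule eq_matI)
    have M: "M \<in> carrier_mat n n" "\<And>i j. i < n \<Longrightarrow> j < n \<Longrightarrow> M $$ (i, j) = 0 \<or> M $$ (i, j) = 1"
      using that unfolding regular_01_mats_def by auto
    show "adj_mat n {(i, j). i < n \<and> j < n \<and> M $$ (i, j) = 1} $$ (i, j) = M $$ (i, j)"
      if "i < dim_row M" "j < dim_col M" for i j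
      using that M(1) M(2)[of i j] unfolding adj_mat_def by auto
  qed (use that in \<open>auto simp: adj_mat_def regular_01_mats_def\<close>)
qed

section \<open>Kernel conditions as sums over neighbourhoods\<close>

lemma sum_of_bool_row:
  fixes x :: "nat \<Rightarrow> real"
  assumes "A \<subseteq> {..<n}"
  shows "(\<Sum>j = 0..<n. of_bool (j \<in> A) * x j) = sum x A"
proof -
  have "(\<Sum>j = 0..<n. of_bool (j \<in> A) * x j) = (\<Sum>j\<in>{0..<n}. if j \<in> A then x j else 0)"
    by (intro sum.cong) auto
  also have "\<dots> = sum x ({0..<n} \<inter> A)" by (simp add: sum.inter_restrict)
  also have "{0..<n} \<inter> A = A" using assms by auto
  finally show ?thesis .
qed

lemma adj_mat_mult_vec:
  assumes E: "E \<in> reg n d" and x: "x \<in> carrier_vec n" and i: "i < n"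
  shows "vec_index (adj_mat n E *\<^sub>v x) i = sum (vec_index x) (E `` {i})"
proof -
  have "vec_index (adj_mat n E *\<^sub>v x) i = (\<Sum>j = 0..<n. of_bool (j \<in> E `` {i}) * vec_index x j)"
    using x i by (simp add: adj_mat_def scalar_prod_def)
  then show ?thesis unfolding sum_of_bool_row[OF reg_Image_subset(1)[OF E]] .
qed

lemma row_mult_adj_mat:
  assumes E: "E \<in> reg n d" and x: "x \<in> carrier_vec n" and j: "j < n"
  shows "(mat_of_row x * adj_mat n E) $$ (0, j) = sum (vec_index x) (E\<inverse> `` {j})"
proof -
  have "(mat_of_row x * adj_mat n E) $$ (0, j) = (\<Sum>i = 0..<n. of_bool (i \<in> E\<inverse> `` {j}) * vec_index x i)"
    using x j by (simp add: adj_mat_def scalar_prod_def mat_of_row_def times_mat_def mult.commute)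
  then show ?thesis unfolding sum_of_bool_row[OF reg_Image_subset(2)[OF E]] .
qed

lemma null_vector_of_almost_constant:
  assumes x: "x \<in> almost_constant n p" and k: "k = nat \<lfloor>p * real n\<rfloor>"
    and ker: "\<And>i. i < n \<Longrightarrow> sum (vec_index x) (E `` {i}) = 0"
  shows "null_vector n k E"
proof -
  obtain a where xn: "x \<in> carrier_vec n" "x \<noteq> 0\<^sub>v n"
    and a: "(1 - p) * real n \<le> real (card {i. i < n \<and> vec_index x i = a})"
    using x unfolding almost_constant_def by blast
  have "\<exists>j<n. vec_index x j \<noteq> 0" using xn by (metis eq_vecI carrier_vecD index_zero_vec)
  moreover have "card {j. j < n \<and> vec_index x j \<noteq> a} \<le> k"
  proof -
    have "card {i. i < n \<and> vec_index x i = a} + card {j. j < n \<and> vec_index x j \<noteq> a}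
        = card ({i. i < n \<and> vec_index x i = a} \<union> {j. j < n \<and> vec_index x j \<noteq> a})"
      by (rule card_Un_disjoint[symmetric]) auto
    also have "{i. i < n \<and> vec_index x i = a} \<union> {j. j < n \<and> vec_index x j \<noteq> a} = {..<n}"
      by auto
    finally have "card {i. i < n \<and> vec_index x i = a} + card {j. j < n \<and> vec_index x j \<noteq> a} = n"
      by simp
    then have "real (card {i. i < n \<and> vec_index x i = a}) + real (card {j. j < n \<and> vec_index x j \<noteq> a}) = real n"
      by (simp only: of_nat_add[symmetric])
    then have "real (card {j. j < n \<and> vec_index x j \<noteq> a}) \<le> p * real n"
      using a by (simp add: left_diff_distrib)
    \<comment> \<open>The number of exceptional coordinates is an integer, so the bound pn may be
      replaced by its floor.\<close>
    then show ?thesis unfolding k by (simp add: le_nat_floor)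
  qed
  ultimately show ?thesis unfolding null_vector_def using ker by blast
qed

lemma adj_mat_in_event_AC:
  assumes E: "E \<in> reg n d" and k: "k = nat \<lfloor>p * real n\<rfloor>"
    and nn: "\<not> null_vector n k E" "\<not> null_vector n k (E\<inverse>)"
  shows "adj_mat n E \<in> event_AC n d p"
  unfolding event_AC_def
proof (intro CollectI conjI ballI)
  show "adj_mat n E \<in> regular_01_mats n d"
    using bij_betw_adj_mat E by (rule bij_betw_apply)
  fix x assume x: "x \<in> almost_constant n p"
  then have xn: "x \<in> carrier_vec n" unfolding almost_constant_def by blast
  show "adj_mat n E *\<^sub>v x \<noteq> 0\<^sub>v n"
  proof
    assume "adj_mat n E *\<^sub>v x = 0\<^sub>v n"
    then have "sum (vec_index x) (E `` {i}) = 0" if "i < n" for i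
      using adj_mat_mult_vec[OF E xn that] that by simp
    then show False using null_vector_of_almost_constant[OF x k] nn(1) by blast
  qed
  show "mat_of_row x * adj_mat n E \<noteq> 0\<^sub>m 1 n"
  proof
    assume "mat_of_row x * adj_mat n E = 0\<^sub>m 1 n"
    then have "sum (vec_index x) (E\<inverse> `` {j}) = 0" if "j < n" for j
      using row_mult_adj_mat[OF E xn that] that by simp
    then show False using null_vector_of_almost_constant[OF x k] nn(2) by blast
  qed
qed

text \<open>Transposition shows that left and right null vectors occur for equally many graphs, so
  doubling the half bound covers both sides.\<close>

lemma measure_event_AC_ge:
  fixes q :: real
  assumes dn: "d \<le> n" and k: "k = nat \<lfloor>p * real n\<rfloor>"
    and le: "real (card {E \<in> reg n d. null_vector n k E}) \<le> 1 / 2 * q * real (card (reg n d))"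
  shows "1 - q \<le> measure (uniform_count_measure (regular_01_mats n d)) (event_AC n d p)"
proof -
  let ?N = "{E \<in> reg n d. null_vector n k E}" and ?N' = "{E \<in> reg n d. null_vector n k (E\<inverse>)}"
  let ?good = "reg n d - (?N \<union> ?N')"
  have inj: "inj_on (adj_mat n) (reg n d)" and im: "adj_mat n ` reg n d = regular_01_mats n d"
    using bij_betw_adj_mat[of n d] unfolding bij_betw_def by auto
  have fin: "finite (regular_01_mats n d)" unfolding im[symmetric] using finite_reg by simp
  have R: "card (regular_01_mats n d) = card (reg n d)" unfolding im[symmetric] by (rule card_image[OF inj])
  have pos: "0 < card (reg n d)" using reg_nonempty[OF dn] finite_reg by (simp add: card_gt_0_iff)
  have sub: "event_AC n d p \<subseteq> regular_01_mats n d" unfolding event_AC_def by blast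
  have "adj_mat n ` ?good \<subseteq> event_AC n d p" using adj_mat_in_event_AC[OF _ k] by blast
  then have "card (adj_mat n ` ?good) \<le> card (event_AC n d p)"
    using sub fin by (intro card_mono finite_subset[OF sub]) auto
  also have "card (adj_mat n ` ?good) = card ?good"
    by (rule card_image, rule inj_on_subset[OF inj]) auto
  finally have "card ?good \<le> card (event_AC n d p)" .
  moreover have "card (reg n d) - card (?N \<union> ?N') \<le> card ?good"
    by (rule diff_card_le_card_Diff) (use finite_reg in auto)
  moreover have "card (?N \<union> ?N') \<le> 2 * card ?N"
    using card_Un_le[of ?N ?N'] card_converse_reg[of n d "null_vector n k"] by simp
  ultimately have "card (reg n d) \<le> card (event_AC n d p) + 2 * card ?N" by linarith
  then have "real (card (reg n d)) \<le> real (card (event_AC n d p) + 2 * card ?N)" by (rule of_nat_mono)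
  then have "(1 - q) * real (card (reg n d)) \<le> real (card (event_AC n d p))"
    using le by (simp add: left_diff_distrib)
  then have "1 - q \<le> real (card (event_AC n d p)) / real (card (reg n d))"
    using pos by (simp add: field_simps)
  also have "\<dots> = measure (uniform_count_measure (regular_01_mats n d)) (event_AC n d p)"
    using measure_uniform_count_measure[OF fin sub] R by simp
  finally show ?thesis .
qed

theorem theorem4p1:
  "\<exists>C c :: real. C > 0 \<and> c > 0 \<and>
     (\<forall>(n::nat) (d::nat) (p::real).
        n > 0 \<longrightarrow> d > 0 \<longrightarrow> C \<le> real d \<longrightarrow> real d \<le> c * real n \<longrightarrow>
        0 < p \<longrightarrow> p < 1 / 2 \<longrightarrow> p \<le> c / ln (real d) \<longrightarrow>
        measure (uniform_count_measure (regular_01_mats n d)) (event_AC n d p)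
          \<ge> 1 - (C * real d / real n) powr (c * real d))"
proof -
  obtain C c :: real where Cc: "C > 0" "c > 0" "c \<le> 1" "3 \<le> C"
    and bound: "\<And>n d k :: nat. C \<le> real d \<Longrightarrow> real d \<le> c * real n \<Longrightarrow> real k \<le> c * real n \<Longrightarrow>
     real (card {E \<in> reg n d. null_vector n k E})
       \<le> 1 / 2 * (C * real d / real n) powr (c * real d) * real (card (reg n d))"
    using card_null_vector_bound by blast
  show ?thesis
  proof (rule exI[of _ C], rule exI[of _ c], intro conjI allI impI Cc)
    fix n d :: nat and p :: real
    assume d: "C \<le> real d" "real d \<le> c * real n" and p: "0 < p" "p \<le> c / ln (real d)"
    define k where "k = nat \<lfloor>p * real n\<rfloor>"
    \<comment> \<open>C \<ge> 3 gives ln d \<ge> 1, so the hypothesis on p yields p \<le> c and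
      \<open>k \<le> c * real n\<close>.\<close>
    have "exp 1 \<le> real d" using exp_le Cc(4) d(1) by linarith
    then have "1 \<le> ln (real d)" using Cc(4) d(1) by (simp add: ln_ge_iff)
    then have "c / ln (real d) \<le> c" using Cc(2) by (simp add: field_simps)
    then have "p \<le> c" using p by linarith
    then have "p * real n \<le> c * real n" by (intro mult_right_mono) auto
    moreover have "real k \<le> p * real n" unfolding k_def using p by simp
    ultimately have k: "real k \<le> c * real n" by linarith
    have "c * real n \<le> 1 * real n" using Cc by (intro mult_right_mono) auto
    then have dn: "d \<le> n" using d by simp
    show "1 - (C * real d / real n) powr (c * real d)
      \<le> measure (uniform_count_measure (regular_01_mats n d)) (event_AC n d p)"
      by (rule measure_event_AC_ge[OF dn k_def bound[OF d k]])
  qed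
qed

end
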